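(* Fix integers $n>1$ and $m\ge 1$. For $k\in\mathbb{Z}/n\mathbb{Z}$ define rational functions on the unipotent loop group $U$ by $$\varepsilon_k(Y)=\frac{y_{k+1,k+m+1}}{y_{k+1,k+m}},\qquad \varphi_k(Y)=\frac{y_{k,k+m}}{y_{k+1,k+m}},$$ and put $\gamma_k=\varphi_k/\varepsilon_k$. Then $U$, together with the rational functions $\varepsilon_k,\varphi_k$ and the maps $$e_k^c:\; Y\longmapsto u_k\big((c-1)\varphi_k(Y)\big)\;Y\;u_{k+m}\big((c^{-1}-1)\varepsilon_k(Y)\big)\qquad (c\in\mathbb{C}^* ),$$ forms an affine geometric crystal of type $A_{n-1}^{(1)}$. Furthermore, the subvariety $U^{\le m}$ is invariant under $e_k^c$ for all $k\in\mathbb{Z}/n\mathbb{Z}$, and thus is a geometric subcrystal.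
   Context: **Loop group.** Let $G=GL_n(\mathbb{C}((t)))$. An element $g=(g_{ij})_{i,j=1}^n$ with $g_{ij}=\sum_k g_{ij}^k t^k$ is identified with the infinite periodic matrix $Y=(y_{rs})_{r,s\in\mathbb{Z}}$ given by $y_{i+kn,\,j+k'n}=g_{ij}^{k'-k}$ for $1\le i,j\le n$; so $y_{r+n,s+n}=y_{rs}$. The unipotent loop group $U\subset G$ is the set of those $Y$ that are upper triangular with $1$'s on the main diagonal. $U^{\le m}\subset U$ is the set of $Y\in U$ with $y_{ij}=0$ whenever $j-i>m$ (so $U^{\le m}\simeq\mathbb{C}^{mn}$, with coordinates $y_{s,s+r}$, $s\in\mathbb{Z}/n\mathbb{Z}$, $1\le r\le m$). By periodicity, expressions such as $y_{k,k+m}$ are well defined for $k\in\mathbb{Z}/n\mathbb{Z}$ (choose any integer representative of $k$). **Chevalley generators.** For $k\in\mathbb{Z}/n\mathbb{Z}$ and $a\in\mathbb{C}$, $u_k(a)\in U$ is the infinite periodic matrix with entries $1$ on the main diagonal, entry $a$ at each position $(i,i+1)$ with $i\equiv k \bmod n$, and all other entries $0$. Products are products of infinite periodic matrices. **Affine geometric crystal of type $A_{n-1}^{(1)}$.** Let $(a_{ij})_{i,j\in\mathbb{Z}/n\mathbb{Z}}$ be the Cartan matrix: for $n>2$, $a_{ii}=2$, $a_{ij}=-1$ if $i-j\equiv\pm1 \bmod n$, and $a_{ij}=0$ otherwise; for $n=2$, $a_{11}=a_{22}=2$, $a_{12}=a_{21}=-2$. A geometric crystal is a complex algebraic variety $X$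 with rational functions $\varepsilon_i,\gamma_i:X\to\mathbb{C}$ and rational $\mathbb{C}^*$-actions $e_i:\mathbb{C}^*\times X\to X$, $(c,x)\mapsto e_i^c(x)$, $i\in\mathbb{Z}/n\mathbb{Z}$, such that (as identities of rational functions/maps, i.e. wherever both sides are defined): (1) the domain of $e_i^1:X\to X$ is dense in $X$ for every $i$; (2) $\gamma_j(e_i^c(x))=c^{a_{ij}}\gamma_j(x)$ for all $i,j$; (3) $\varepsilon_i(e_i^c(x))=c^{-1}\varepsilon_i(x)$; (4) $e_i^c e_j^{c'}=e_j^{c'}e_i^c$ for $i\ne j$ with $a_{ij}=0$; (5) $e_i^c e_j^{cc'} e_i^{c'}=e_j^{c'}e_i^{cc'}e_j^{c}$ for $i\neq j$ with $a_{ij}=-1$. One sets $\varphi_i=\gamma_i\varepsilon_i$; a geometric crystal may be specified by giving $\varphi_i,\varepsilon_i$ instead of $\gamma_i,\varepsilon_i$. *)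

theory Defs
  imports
    "HOL-Analysis.Function_Topology"
    "HOL-Computational_Algebra.Formal_Laurent_Series"
    "HOL-Number_Theory.Cong"
    "Jordan_Normal_Form.Matrix"
begin

section \<open>Affine varieties, rational functions and rational maps over the complex numbers\<close>

text \<open>
  A variety is given by its set of closed points and its coordinate ring, viewed as a ring of
  complex-valued functions. Only the values on the points matter. The coordinate ring need not be
  finitely generated, because the unipotent loop group is infinite-dimensional.
\<close>

record 'a variety =
  points :: "'a set"
  coord_ring :: "('a \<Rightarrow> complex) set"

inductive_set generated_algebra :: "('a \<Rightarrow> complex) set \<Rightarrow> ('a \<Rightarrow> complex) set"
  for F :: "('a \<Rightarrow> complex) set" where
  gen: "f \<in> F \<Longrightarrow> f \<in> generated_algebra F"
| const: "(\<lambda>_. c) \<in> generated_algebra F"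
| add: "f \<in> generated_algebra F \<Longrightarrow> g \<in> generated_algebra F \<Longrightarrow> (\<lambda>x. f x + g x) \<in> generated_algebra F"
| mult: "f \<in> generated_algebra F \<Longrightarrow> g \<in> generated_algebra F \<Longrightarrow> (\<lambda>x. f x * g x) \<in> generated_algebra F"

definition zariski :: "'a variety \<Rightarrow> 'a topology" where
  "zariski V = topology_generated_by {{x \<in> points V. f x \<noteq> 0} |f. f \<in> coord_ring V}"

definition zariski_dense :: "'a variety \<Rightarrow> 'a set \<Rightarrow> bool" where
  "zariski_dense V S \<longleftrightarrow> zariski V closure_of S = points V"

text \<open>Complex algebra homomorphisms from the coordinate ring, as a ring of functions on the points,
  to the complex numbers.\<close>

definition character :: "'a variety \<Rightarrow> (('a \<Rightarrow> complex) \<Rightarrow> complex) \<Rightarrow> bool" where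
  "character V h \<longleftrightarrow>
     (\<forall>f\<in>coord_ring V. \<forall>g\<in>coord_ring V. (\<forall>x\<in>points V. f x = g x) \<longrightarrow> h f = h g) \<and>
     (\<forall>c. h (\<lambda>_. c) = c) \<and>
     (\<forall>f\<in>coord_ring V. \<forall>g\<in>coord_ring V. h (\<lambda>x. f x + g x) = h f + h g) \<and>
     (\<forall>f\<in>coord_ring V. \<forall>g\<in>coord_ring V. h (\<lambda>x. f x * g x) = h f * h g)"

text \<open>
  Irreducible affine varieties. The clause on characters says that the points are exactly the
  complex points of the spectrum of the coordinate ring (in particular, regular functions
  separate points).
\<close>

definition affine_variety :: "'a variety \<Rightarrow> bool" where
  "affine_variety V \<longleftrightarrow>
     points V \<noteq> {} \<and>
     generated_algebra (coord_ring V) = coord_ring V \<and>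
     (\<forall>h. character V h \<longrightarrow> (\<exists>!x. x \<in> points V \<and> (\<forall>f\<in>coord_ring V. h f = f x))) \<and>
     (\<forall>A B. openin (zariski V) A \<and> openin (zariski V) B \<and> A \<noteq> {} \<and> B \<noteq> {} \<longrightarrow> A \<inter> B \<noteq> {})"

definition prod_variety :: "'a variety \<Rightarrow> 'b variety \<Rightarrow> ('a \<times> 'b) variety"  (infixr \<open>\<times>\<^sub>v\<close> 80) where
  "V \<times>\<^sub>v W = \<lparr>points = points V \<times> points W,
     coord_ring = generated_algebra ((\<lambda>f. f \<circ> fst) ` coord_ring V \<union> (\<lambda>g. g \<circ> snd) ` coord_ring W)\<rparr>"

definition Gm :: "complex variety" where
  "Gm = \<lparr>points = - {0}, coord_ring = generated_algebra {\<lambda>c. c, inverse}\<rparr>"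

definition subvariety :: "'a variety \<Rightarrow> 'a set \<Rightarrow> 'a variety" where
  "subvariety V Z = V\<lparr>points := Z\<rparr>"

text \<open>
  Rational functions and rational maps are given by representatives: partial functions defined on
  a dense open set and regular there.
\<close>

definition rational_function :: "'a variety \<Rightarrow> ('a \<rightharpoonup> complex) \<Rightarrow> bool" where
  "rational_function V f \<longleftrightarrow>
     openin (zariski V) (dom f) \<and> zariski_dense V (dom f) \<and>
     (\<forall>x\<in>dom f. \<exists>p\<in>coord_ring V. \<exists>q\<in>coord_ring V.
        q x \<noteq> 0 \<and> (\<forall>z\<in>dom f. q z \<noteq> 0 \<longrightarrow> f z = Some (p z / q z)))"

definition rational_map :: "'a variety \<Rightarrow> 'b variety \<Rightarrow> ('a \<rightharpoonup> 'b) \<Rightarrow> bool" where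
  "rational_map V W f \<longleftrightarrow>
     openin (zariski V) (dom f) \<and> zariski_dense V (dom f) \<and> ran f \<subseteq> points W \<and>
     (\<forall>g\<in>coord_ring W. rational_function V (\<lambda>x. map_option g (f x)))"

text \<open>
  Identity of (compositions of) rational maps: both sides are generically defined, and they agree
  wherever both are defined.
\<close>

definition rational_eq :: "'a variety \<Rightarrow> ('a \<rightharpoonup> 'b) \<Rightarrow> ('a \<rightharpoonup> 'b) \<Rightarrow> bool" where
  "rational_eq V f g \<longleftrightarrow>
     zariski_dense V (points V \<inter> dom f) \<and> zariski_dense V (points V \<inter> dom g) \<and>
     (\<forall>x \<in> points V \<inter> dom f \<inter> dom g. f x = g x)"

definition rational_div :: "('a \<rightharpoonup> complex) \<Rightarrow> ('a \<rightharpoonup> complex) \<Rightarrow> ('a \<rightharpoonup> complex)" where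
  "rational_div f g = (\<lambda>x. case (f x, g x) of
     (Some a, Some b) \<Rightarrow> if b \<noteq> 0 then Some (a / b) else None | _ \<Rightarrow> None)"

definition rational_action :: "'a variety \<Rightarrow> (complex \<Rightarrow> 'a \<rightharpoonup> 'a) \<Rightarrow> bool" where
  "rational_action X e \<longleftrightarrow>
     rational_map (Gm \<times>\<^sub>v X) X (\<lambda>(c, x). e c x) \<and>
     rational_eq X (e 1) Some \<and>
     rational_eq (Gm \<times>\<^sub>v Gm \<times>\<^sub>v X)
       (\<lambda>(c, c', x). (e c \<circ>\<^sub>m e c') x) (\<lambda>(c, c', x). e (c * c') x)"

section \<open>Affine geometric crystals\<close>

text \<open>Indices in \<open>\<int>/n\<int>\<close> are represented by integers; families indexed by \<open>\<int>/n\<int>\<close> are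
  \<open>n\<close>-periodic families indexed by integers.\<close>

definition cartan :: "nat \<Rightarrow> int \<Rightarrow> int \<Rightarrow> int" where
  "cartan n i j =
     (if [i = j] (mod int n) then 2
      else if n = 2 then - 2
      else if [i - j = 1] (mod int n) \<or> [i - j = - 1] (mod int n) then - 1
      else 0)"

definition geometric_crystal ::
  "nat \<Rightarrow> 'a variety \<Rightarrow> (int \<Rightarrow> 'a \<rightharpoonup> complex) \<Rightarrow> (int \<Rightarrow> 'a \<rightharpoonup> complex) \<Rightarrow>
   (int \<Rightarrow> complex \<Rightarrow> 'a \<rightharpoonup> 'a) \<Rightarrow> bool" where
  "geometric_crystal n X \<epsilon> \<gamma> e \<longleftrightarrow>
     affine_variety X \<and>
     (\<forall>i. \<epsilon> (i + int n) = \<epsilon> i \<and> \<gamma> (i + int n) = \<gamma> i \<and> e (i + int n) = e i) \<and>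
     (\<forall>i. rational_function X (\<epsilon> i) \<and> rational_function X (\<gamma> i) \<and> rational_action X (e i)) \<and>
     (\<forall>i. zariski_dense X (dom (e i 1))) \<and>
     (\<forall>i j. rational_eq (Gm \<times>\<^sub>v X)
        (\<lambda>(c, x). (\<gamma> j \<circ>\<^sub>m e i c) x)
        (\<lambda>(c, x). map_option (\<lambda>a. c powi cartan n i j * a) (\<gamma> j x))) \<and>
     (\<forall>i. rational_eq (Gm \<times>\<^sub>v X)
        (\<lambda>(c, x). (\<epsilon> i \<circ>\<^sub>m e i c) x)
        (\<lambda>(c, x). map_option (\<lambda>a. inverse c * a) (\<epsilon> i x))) \<and>
     (\<forall>i j. \<not> [i = j] (mod int n) \<and> cartan n i j = 0 \<longrightarrow>
        rational_eq (Gm \<times>\<^sub>v Gm \<times>\<^sub>v X)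
          (\<lambda>(c, c', x). (e i c \<circ>\<^sub>m e j c') x)
          (\<lambda>(c, c', x). (e j c' \<circ>\<^sub>m e i c) x)) \<and>
     (\<forall>i j. \<not> [i = j] (mod int n) \<and> cartan n i j = - 1 \<longrightarrow>
        rational_eq (Gm \<times>\<^sub>v Gm \<times>\<^sub>v X)
          (\<lambda>(c, c', x). (e i c \<circ>\<^sub>m e j (c * c') \<circ>\<^sub>m e i c') x)
          (\<lambda>(c, c', x). (e j c' \<circ>\<^sub>m e i (c * c') \<circ>\<^sub>m e j c) x))"

text \<open>The same structure, specified by \<open>\<phi>\<^sub>i = \<gamma>\<^sub>i \<epsilon>\<^sub>i\<close> instead of \<open>\<gamma>\<^sub>i\<close>.\<close>

definition geometric_crystal_phi ::
  "nat \<Rightarrow> 'a variety \<Rightarrow> (int \<Rightarrow> 'a \<rightharpoonup> complex) \<Rightarrow> (int \<Rightarrow> 'a \<rightharpoonup> complex) \<Rightarrow>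
   (int \<Rightarrow> complex \<Rightarrow> 'a \<rightharpoonup> 'a) \<Rightarrow> bool" where
  "geometric_crystal_phi n X \<epsilon> \<phi> e \<longleftrightarrow>
     (\<forall>i. \<phi> (i + int n) = \<phi> i \<and> rational_function X (\<phi> i)) \<and>
     geometric_crystal n X \<epsilon> (\<lambda>i. rational_div (\<phi> i) (\<epsilon> i)) e"

definition invariant_subset :: "(int \<Rightarrow> complex \<Rightarrow> 'a \<rightharpoonup> 'a) \<Rightarrow> 'a set \<Rightarrow> bool" where
  "invariant_subset e Z \<longleftrightarrow> (\<forall>i c x y. c \<noteq> 0 \<and> x \<in> Z \<and> e i c x = Some y \<longrightarrow> y \<in> Z)"

definition geometric_subcrystal ::
  "nat \<Rightarrow> 'a variety \<Rightarrow> (int \<Rightarrow> 'a \<rightharpoonup> complex) \<Rightarrow> (int \<Rightarrow> 'a \<rightharpoonup> complex) \<Rightarrow>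
   (int \<Rightarrow> complex \<Rightarrow> 'a \<rightharpoonup> 'a) \<Rightarrow> 'a set \<Rightarrow> bool" where
  "geometric_subcrystal n X \<epsilon> \<phi> e Z \<longleftrightarrow>
     closedin (zariski X) Z \<and> invariant_subset e Z \<and>
     geometric_crystal_phi n (subvariety X Z)
       (\<lambda>i. \<epsilon> i |` Z) (\<lambda>i. \<phi> i |` Z) (\<lambda>i c. e i c |` Z)"

section \<open>The unipotent loop group\<close>

type_synonym inf_matrix = "int \<Rightarrow> int \<Rightarrow> complex"

definition loop_group :: "nat \<Rightarrow> complex fls mat set" where
  "loop_group n = {g \<in> carrier_mat n n. invertible_mat g}"

text \<open>The matrix with entries \<open>y\<^bsub>i+kn, j+k'n\<^esub> = g\<^bsub>ij\<^esub>\<^bsup>k'-k\<^esup>\<close> for \<open>1 \<le> i, j \<le> n\<close>; the shift by one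
  is due to matrix indices starting at \<open>0\<close>.\<close>

definition periodic_matrix :: "nat \<Rightarrow> complex fls mat \<Rightarrow> inf_matrix" where
  "periodic_matrix n g = (\<lambda>r s.
     fls_nth (index_mat g (nat ((r - 1) mod int n), nat ((s - 1) mod int n)))
       ((s - 1) div int n - (r - 1) div int n))"

definition unipotent_loop_group :: "nat \<Rightarrow> inf_matrix set" where
  "unipotent_loop_group n =
     {Y \<in> periodic_matrix n ` loop_group n. (\<forall>r. Y r r = 1) \<and> (\<forall>r s. s < r \<longrightarrow> Y r s = 0)}"

definition banded_unipotent :: "nat \<Rightarrow> nat \<Rightarrow> inf_matrix set" where
  "banded_unipotent n m = {Y \<in> unipotent_loop_group n. \<forall>i j. j - i > int m \<longrightarrow> Y i j = 0}"

text \<open>The regular functions are the polynomials in finitely many matrix entries.\<close>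

definition U_variety :: "nat \<Rightarrow> inf_matrix variety" where
  "U_variety n = \<lparr>points = unipotent_loop_group n,
     coord_ring = generated_algebra {\<lambda>Y. Y r s |r s. True}\<rparr>"

text \<open>For periodic matrices coming from the loop group, all these sums are finite.\<close>

definition inf_mult :: "inf_matrix \<Rightarrow> inf_matrix \<Rightarrow> inf_matrix"  (infixl \<open>\<otimes>\<^sub>m\<close> 70) where
  "A \<otimes>\<^sub>m B = (\<lambda>r s. \<Sum>t | A r t * B t s \<noteq> 0. A r t * B t s)"

definition chevalley :: "nat \<Rightarrow> int \<Rightarrow> complex \<Rightarrow> inf_matrix" where
  "chevalley n k a = (\<lambda>i j.
     if j = i then 1 else if j = i + 1 \<and> [i = k] (mod int n) then a else 0)"

definition U_eps :: "nat \<Rightarrow> nat \<Rightarrow> int \<Rightarrow> inf_matrix \<rightharpoonup> complex" where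
  "U_eps n m k = (\<lambda>Y. Some (Y (k + 1) (k + int m + 1) / Y (k + 1) (k + int m)))
     |` {Y \<in> unipotent_loop_group n. Y (k + 1) (k + int m) \<noteq> 0}"

definition U_phi :: "nat \<Rightarrow> nat \<Rightarrow> int \<Rightarrow> inf_matrix \<rightharpoonup> complex" where
  "U_phi n m k = (\<lambda>Y. Some (Y k (k + int m) / Y (k + 1) (k + int m)))
     |` {Y \<in> unipotent_loop_group n. Y (k + 1) (k + int m) \<noteq> 0}"

definition U_e :: "nat \<Rightarrow> nat \<Rightarrow> int \<Rightarrow> complex \<Rightarrow> inf_matrix \<rightharpoonup> inf_matrix" where
  "U_e n m k c = (\<lambda>Y. case (U_phi n m k Y, U_eps n m k Y) of
     (Some p, Some q) \<Rightarrow>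
       if c \<noteq> 0
       then Some (chevalley n k ((c - 1) * p) \<otimes>\<^sub>m Y \<otimes>\<^sub>m chevalley n (k + int m) ((inverse c - 1) * q))
       else None
   | _ \<Rightarrow> None)"

end

theory Submission
  imports Defs "Jordan_Normal_Form.Determinant"
begin

text \<open>
  Multiplying by Chevalley generators means adding multiples of rows and of columns, so
  \<open>e\<^sub>k\<^sup>c\<close> is a row operation followed by a column operation. Three entries of \<open>Y\<close> determine it: the
  pivot \<open>y\<^bsub>k+1,k+m\<^esub>\<close>, which it fixes, and its neighbours \<open>y\<^bsub>k,k+m\<^esub>\<close> and \<open>y\<^bsub>k+1,k+m+1\<^esub>\<close>, which it
  multiplies by \<open>c\<close> and by \<open>c\<^sup>-\<^sup>1\<close>. Hence \<open>e\<^sub>k\<^sup>c e\<^sub>k\<^sup>d = e\<^sub>k\<^bsup>cd\<^esup>\<close> and the scaling of \<open>\<epsilon>\<^sub>k\<close>. The functions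
  \<open>\<gamma>\<^sub>j = y\<^bsub>j,j+m\<^esub> / y\<^bsub>j+1,j+m+1\<^esub>\<close> are quotients of consecutive entries of one superdiagonal, on which
  \<open>e\<^sub>k\<^sup>c\<close> acts diagonally; this gives the Cartan matrix. For distant indices neither
  operator changes the entries that determine the other. For neighbouring indices the relation
  \<open>u\<^sub>i(a\<^sub>1) u\<^sub>j(a\<^sub>2) u\<^sub>i(a\<^sub>3) = u\<^sub>j(b\<^sub>1) u\<^sub>i(b\<^sub>2) u\<^sub>j(b\<^sub>3)\<close> of the unipotent group reduces the braid relation to
  identities between rational functions of six entries (\<open>crystal_step_braid\<close>).

  The geometric part rests on two observations. First, \<open>U\<close>, its banded part and their products
  with tori are joined by rational curves (straight lines, away from finitely many parameters), so
  nonempty open sets meet and each is dense (\<open>irreducible\<close>). Secondly, \<open>e\<^sub>k\<^sup>1\<close> is the identity where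
  it is defined. Thus a composition of operators is defined at parameters 1 and a matrix all of whose relevant entries
  are nonzero, and, its entries being regular there, also in a neighbourhood
  (\<open>based_family_E\<close>). Every density claim follows from this.

  A band matrix stays a band matrix because on the first superdiagonal outside the band the row and
  the column operation cancel (\<open>crystal_step_band\<close>). All axioms are proved for both varieties at
  once. That points of \<open>U\<close> are all periodic unitriangular matrices, needed to recognise them as
  the complex points of the coordinate ring, comes down to a determinant with constant term 1.
\<close>

section \<open>Zariski topology on varieties joined by rational curves\<close>

lemma generated_algebra_idem [simp]:
  "generated_algebra (generated_algebra F) = generated_algebra F"
proof (intro equalityI subsetI)
  fix f assume "f \<in> generated_algebra (generated_algebra F)"
  then show "f \<in> generated_algebra F"
    by induction (auto intro: generated_algebra.intros)
qed (rule generated_algebra.gen)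

text \<open>At the parameters in \<open>B\<close> the curve may leave the variety: a line in \<open>\<complex>\<close> joining two
  nonzero numbers may pass through 0. Regular functions restrict to quotients \<open>p / q\<close>, with \<open>q\<close> free of zeros off \<open>B\<close>.\<close>

definition joined_by_rational_curve :: "'a variety \<Rightarrow> 'a \<Rightarrow> 'a \<Rightarrow> bool" where
  "joined_by_rational_curve V x y \<longleftrightarrow>
     (\<exists>L B. finite B \<and> (0::complex) \<notin> B \<and> 1 \<notin> B \<and> L 0 = x \<and> L 1 = y \<and>
        (\<forall>t. t \<notin> B \<longrightarrow> L t \<in> points V) \<and>
        (\<forall>f\<in>coord_ring V. \<exists>p q. \<forall>t. t \<notin> B \<longrightarrow> poly q t \<noteq> 0 \<and> f (L t) * poly q t = poly p t))"

lemma rational_restriction_generated: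
  fixes L :: "complex \<Rightarrow> 'a"
  assumes "f \<in> generated_algebra F"
    and "\<And>f. f \<in> F \<Longrightarrow> \<exists>p q. \<forall>t. t \<notin> B \<longrightarrow> poly q t \<noteq> 0 \<and> f (L t) * poly q t = poly p t"
  shows "\<exists>p q. \<forall>t. t \<notin> B \<longrightarrow> poly q t \<noteq> 0 \<and> f (L t) * poly q t = poly p t"
  using assms(1)
proof induction
  case (gen f)
  then show ?case by (rule assms(2))
next
  case (const c)
  show ?case by (rule exI[of _ "[:c:]"], rule exI[of _ 1]) simp
next
  case (add f g)
  then obtain p q p' q' where
    "\<forall>t. t \<notin> B \<longrightarrow> poly q t \<noteq> 0 \<and> f (L t) * poly q t = poly p t"
    "\<forall>t. t \<notin> B \<longrightarrow> poly q' t \<noteq> 0 \<and> g (L t) * poly q' t = poly p' t" by blast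
  then show ?case
    by (intro exI[of _ "p * q' + p' * q"] exI[of _ "q * q'"]) (simp add: ring_distribs ac_simps)
next
  case (mult f g)
  then obtain p q p' q' where
    "\<forall>t. t \<notin> B \<longrightarrow> poly q t \<noteq> 0 \<and> f (L t) * poly q t = poly p t"
    "\<forall>t. t \<notin> B \<longrightarrow> poly q' t \<noteq> 0 \<and> g (L t) * poly q' t = poly p' t" by blast
  then show ?case
    by (intro exI[of _ "p * p'"] exI[of _ "q * q'"])
       (simp add: mult.assoc mult.left_commute[of "g _"])
qed

text \<open>As a condition on germs, regularity is stable under the field operations; thus it can be checked
  factor by factor for iterated rational maps, whose explicit fractions would be unmanageable.\<close>

definition regular_at :: "'a variety \<Rightarrow> 'a \<Rightarrow> ('a \<Rightarrow> complex) \<Rightarrow> bool" where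
  "regular_at V x h \<longleftrightarrow>
     (\<exists>p\<in>coord_ring V. \<exists>q\<in>coord_ring V. q x \<noteq> 0 \<and> (\<forall>z\<in>points V. q z \<noteq> 0 \<longrightarrow> h z = p z / q z))"

locale curve_connected_variety =
  fixes V :: "'a variety"
  assumes coord_ring_closed: "generated_algebra (coord_ring V) = coord_ring V"
    and joined: "x \<in> points V \<Longrightarrow> y \<in> points V \<Longrightarrow> joined_by_rational_curve V x y"
begin

lemma const_in_ring: "(\<lambda>_. c) \<in> coord_ring V"
  using generated_algebra.const[of c "coord_ring V"] by (simp add: coord_ring_closed)

lemma add_in_ring: "f \<in> coord_ring V \<Longrightarrow> g \<in> coord_ring V \<Longrightarrow> (\<lambda>x. f x + g x) \<in> coord_ring V"
  using generated_algebra.add[of f "coord_ring V" g] by (simp add: coord_ring_closed)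

lemma mult_in_ring: "f \<in> coord_ring V \<Longrightarrow> g \<in> coord_ring V \<Longrightarrow> (\<lambda>x. f x * g x) \<in> coord_ring V"
  using generated_algebra.mult[of f "coord_ring V" g] by (simp add: coord_ring_closed)

lemma openin_basic: "f \<in> coord_ring V \<Longrightarrow> openin (zariski V) {x \<in> points V. f x \<noteq> 0}"
  unfolding zariski_def by (rule topology_generated_by_Basis) blast

lemma topspace_zariski: "topspace (zariski V) = points V"
proof -
  have "points V \<subseteq> (\<Union>f\<in>coord_ring V. {x \<in> points V. f x \<noteq> 0})"
    using const_in_ring[of 1] by auto
  then show ?thesis
    unfolding zariski_def topology_generated_by_topspace by blast
qed

lemma openin_imp_basic:
  assumes "openin (zariski V) S" "x \<in> S"
  shows "\<exists>f\<in>coord_ring V. f x \<noteq> 0 \<and> {z \<in> points V. f z \<noteq> 0} \<subseteq> S"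
proof -
  have "generate_topology_on {{x \<in> points V. f x \<noteq> 0} |f. f \<in> coord_ring V} S"
    using assms(1) unfolding zariski_def by (simp add: openin_topology_generated_by_iff)
  then show ?thesis using assms(2)
  proof induction
    case (Int a b)
    then obtain f g where "f \<in> coord_ring V" "f x \<noteq> 0" "{z \<in> points V. f z \<noteq> 0} \<subseteq> a"
      and "g \<in> coord_ring V" "g x \<noteq> 0" "{z \<in> points V. g z \<noteq> 0} \<subseteq> b" by blast
    then show ?case
      by (intro bexI[of _ "\<lambda>z. f z * g z"]) (auto intro: mult_in_ring)
  next
    case (UN K)
    then show ?case by (meson Union_iff subset_iff)
  qed auto
qed

lemma eventually_zariski:
  assumes "x \<in> points V"
  shows "eventually Q (nhdsin (zariski V) x) \<longleftrightarrow>
    (\<exists>f\<in>coord_ring V. f x \<noteq> 0 \<and> (\<forall>z\<in>points V. f z \<noteq> 0 \<longrightarrow> Q z))"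
  (is "_ \<longleftrightarrow> ?R")
proof
  assume "eventually Q (nhdsin (zariski V) x)"
  then obtain S where "openin (zariski V) S" "x \<in> S" "\<forall>z\<in>S. Q z"
    using assms by (auto simp: eventually_nhdsin topspace_zariski)
  then show ?R using openin_imp_basic[of S x] by blast
next
  assume ?R
  then obtain f where "f \<in> coord_ring V" "f x \<noteq> 0" "\<forall>z\<in>points V. f z \<noteq> 0 \<longrightarrow> Q z" by blast
  then show "eventually Q (nhdsin (zariski V) x)"
    using assms openin_basic[of f] unfolding eventually_nhdsin by blast
qed

text \<open>On a curve from a point of \<open>S\<close> to a point of \<open>T\<close>, the functions \<open>f\<close> and \<open>g\<close> that cut out basic
  neighbourhoods become nonzero fractions in one parameter; all but finitely many parameters avoid
  the zeros of both.\<close>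

lemma irreducible:
  assumes "openin (zariski V) S" "openin (zariski V) T" "S \<noteq> {}" "T \<noteq> {}"
  shows "S \<inter> T \<noteq> {}"
proof -
  obtain x y where xy: "x \<in> S" "y \<in> T" using assms by blast
  obtain f where f: "f \<in> coord_ring V" "f x \<noteq> 0" "{z \<in> points V. f z \<noteq> 0} \<subseteq> S"
    using openin_imp_basic[OF assms(1) xy(1)] by blast
  obtain g where g: "g \<in> coord_ring V" "g y \<noteq> 0" "{z \<in> points V. g z \<noteq> 0} \<subseteq> T"
    using openin_imp_basic[OF assms(2) xy(2)] by blast
  have "x \<in> points V" "y \<in> points V"
    using assms(1,2) xy openin_subset topspace_zariski by blast+
  from joined[OF this] obtain L B where L: "finite B" "(0::complex) \<notin> B" "1 \<notin> B"
    "L 0 = x" "L 1 = y" "\<And>t. t \<notin> B \<Longrightarrow> L t \<in> points V"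
    and ring: "\<forall>f\<in>coord_ring V. \<exists>p q. \<forall>t. t \<notin> B \<longrightarrow> poly q t \<noteq> 0 \<and> f (L t) * poly q t = poly p t"
    unfolding joined_by_rational_curve_def by blast
  obtain p q where p: "\<And>t. t \<notin> B \<Longrightarrow> poly q t \<noteq> 0 \<and> f (L t) * poly q t = poly p t"
    using ring f(1) by blast
  obtain p' q' where p': "\<And>t. t \<notin> B \<Longrightarrow> poly q' t \<noteq> 0 \<and> g (L t) * poly q' t = poly p' t"
    using ring g(1) by blast
  have "poly p 0 \<noteq> 0" "poly p' 1 \<noteq> 0"
    using p[of 0] p'[of 1] L f(2) g(2) by (metis mult_eq_0_iff)+
  then have "p * p' \<noteq> 0" by auto
  then have "finite ({t. poly (p * p') t = 0} \<union> B)" using L(1) poly_roots_finite by blast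
  then obtain t where t: "poly (p * p') t \<noteq> 0" "t \<notin> B"
    using ex_new_if_finite[OF infinite_UNIV_char_0] by blast
  then have "f (L t) \<noteq> 0" "g (L t) \<noteq> 0" using p[of t] p'[of t] by auto
  then show ?thesis using L(6)[OF t(2)] f(3) g(3) by blast
qed

lemma zariski_dense_if_eventually:
  assumes "x \<in> points V" "eventually (\<lambda>z. z \<in> S) (nhdsin (zariski V) x)"
  shows "zariski_dense V S"
proof -
  obtain A where A: "openin (zariski V) A" "x \<in> A" "A \<subseteq> S"
    using assms by (auto simp: eventually_nhdsin topspace_zariski)
  have "y \<in> zariski V closure_of S" if "y \<in> points V" for y
    unfolding in_closure_of using that irreducible[OF A(1)] A by (fastforce simp: topspace_zariski)
  then show ?thesis
    unfolding zariski_dense_def using closure_of_subset_topspace[of "zariski V" S]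
    by (auto simp: topspace_zariski)
qed

lemma zariski_dense_openin:
  assumes "openin (zariski V) S" "x \<in> S"
  shows "zariski_dense V S"
  using assms openin_subset[OF assms(1)]
  by (intro zariski_dense_if_eventually[of x]) (auto simp: eventually_nhdsin topspace_zariski)

lemma regular_at_ring: "f \<in> coord_ring V \<Longrightarrow> regular_at V x f"
  unfolding regular_at_def by (rule bexI[of _ f], rule bexI[of _ "\<lambda>_. 1"]) (auto intro: const_in_ring)

lemma regular_at_const: "regular_at V x (\<lambda>_. c)"
  by (intro regular_at_ring const_in_ring)

lemma regular_at_add:
  assumes "regular_at V x f" "regular_at V x g"
  shows "regular_at V x (\<lambda>z. f z + g z)"
proof -
  obtain p q p' q' where *: "p \<in> coord_ring V" "q \<in> coord_ring V" "p' \<in> coord_ring V"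
    "q' \<in> coord_ring V" "q x \<noteq> 0" "q' x \<noteq> 0"
    "\<forall>z\<in>points V. q z \<noteq> 0 \<longrightarrow> f z = p z / q z" "\<forall>z\<in>points V. q' z \<noteq> 0 \<longrightarrow> g z = p' z / q' z"
    using assms unfolding regular_at_def by metis
  show ?thesis unfolding regular_at_def
    by (rule bexI[of _ "\<lambda>z. p z * q' z + p' z * q z"], rule bexI[of _ "\<lambda>z. q z * q' z"])
       (use * in \<open>auto intro!: mult_in_ring add_in_ring simp: field_simps\<close>)
qed

lemma regular_at_mult:
  assumes "regular_at V x f" "regular_at V x g"
  shows "regular_at V x (\<lambda>z. f z * g z)"
proof -
  obtain p q p' q' where *: "p \<in> coord_ring V" "q \<in> coord_ring V" "p' \<in> coord_ring V"
    "q' \<in> coord_ring V" "q x \<noteq> 0" "q' x \<noteq> 0"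
    "\<forall>z\<in>points V. q z \<noteq> 0 \<longrightarrow> f z = p z / q z" "\<forall>z\<in>points V. q' z \<noteq> 0 \<longrightarrow> g z = p' z / q' z"
    using assms unfolding regular_at_def by metis
  show ?thesis unfolding regular_at_def
    by (rule bexI[of _ "\<lambda>z. p z * p' z"], rule bexI[of _ "\<lambda>z. q z * q' z"])
       (use * in \<open>auto intro!: mult_in_ring\<close>)
qed

lemma regular_at_inverse:
  assumes "regular_at V x f" "f x \<noteq> 0" "x \<in> points V"
  shows "regular_at V x (\<lambda>z. inverse (f z))"
proof -
  obtain p q where *: "p \<in> coord_ring V" "q \<in> coord_ring V" "q x \<noteq> 0"
    "\<forall>z\<in>points V. q z \<noteq> 0 \<longrightarrow> f z = p z / q z"
    using assms unfolding regular_at_def by metis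
  show ?thesis unfolding regular_at_def
    \<comment> \<open>The fraction \<open>q / p\<close> is expanded by \<open>q\<close>: nothing is known about \<open>f\<close> where \<open>q\<close> vanishes.\<close>
    by (rule bexI[of _ "\<lambda>z. q z * q z"], rule bexI[of _ "\<lambda>z. p z * q z"])
       (use * assms in \<open>auto intro!: mult_in_ring\<close>)
qed

lemma regular_at_diff:
  "regular_at V x f \<Longrightarrow> regular_at V x g \<Longrightarrow> regular_at V x (\<lambda>z. f z - g z)"
  using regular_at_add[OF _ regular_at_mult[OF regular_at_const[of x "- 1"]], of f g] by simp

lemma regular_at_divide:
  assumes "regular_at V x f" "regular_at V x g" "g x \<noteq> 0" "x \<in> points V"
  shows "regular_at V x (\<lambda>z. f z / g z)"
  using regular_at_mult[OF assms(1) regular_at_inverse[OF assms(2-4)]] by (simp add: field_simps)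

lemmas regular_at_intros =
  regular_at_const regular_at_add regular_at_mult regular_at_inverse regular_at_diff regular_at_divide

lemma regular_at_eventually_nonzero:
  assumes "regular_at V x h" "h x \<noteq> 0" "x \<in> points V"
  shows "eventually (\<lambda>z. h z \<noteq> 0) (nhdsin (zariski V) x)"
proof -
  obtain p q where *: "p \<in> coord_ring V" "q \<in> coord_ring V" "q x \<noteq> 0"
    "\<forall>z\<in>points V. q z \<noteq> 0 \<longrightarrow> h z = p z / q z"
    using assms unfolding regular_at_def by metis
  show ?thesis unfolding eventually_zariski[OF assms(3)]
    by (rule bexI[of _ "\<lambda>z. p z * q z"]) (use * assms in \<open>auto intro!: mult_in_ring\<close>)
qed

lemma rational_functionI:
  assumes "openin (zariski V) S" "S \<noteq> {}" "\<And>x. x \<in> S \<Longrightarrow> regular_at V x h"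
    and f: "\<And>x. f x = (if x \<in> S then Some (h x) else None)"
  shows "rational_function V f"
proof -
  have dom: "dom f = S" using f by (auto simp: dom_def)
  show ?thesis
    unfolding rational_function_def dom
  proof (intro conjI ballI)
    show "zariski_dense V S" using zariski_dense_openin assms(1,2) by blast
    fix x assume "x \<in> S"
    then show "\<exists>p\<in>coord_ring V. \<exists>q\<in>coord_ring V. q x \<noteq> 0 \<and>
        (\<forall>z\<in>S. q z \<noteq> 0 \<longrightarrow> f z = Some (p z / q z))"
      using assms(3)[of x] openin_subset[OF assms(1)]
      by (simp add: topspace_zariski f regular_at_def subset_iff) blast
  qed fact
qed

end

lemma curve_connected_prod:
  assumes "curve_connected_variety V" "curve_connected_variety W"
  shows "curve_connected_variety (V \<times>\<^sub>v W)"
proof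
  interpret V: curve_connected_variety V by fact
  interpret W: curve_connected_variety W by fact
  show "generated_algebra (coord_ring (V \<times>\<^sub>v W)) = coord_ring (V \<times>\<^sub>v W)"
    by (simp add: prod_variety_def)
  fix a b assume "a \<in> points (V \<times>\<^sub>v W)" "b \<in> points (V \<times>\<^sub>v W)"
  then obtain x x' y y' where ab: "a = (x, y)" "b = (x', y')" "x \<in> points V" "x' \<in> points V"
    "y \<in> points W" "y' \<in> points W" by (auto simp: prod_variety_def)
  obtain L B where L: "finite B" "(0::complex) \<notin> B" "1 \<notin> B"
    "L 0 = x" "L 1 = x'" "\<And>t. t \<notin> B \<Longrightarrow> L t \<in> points V"
    "\<forall>f\<in>coord_ring V. \<exists>p q. \<forall>t. t \<notin> B \<longrightarrow> poly q t \<noteq> 0 \<and> f (L t) * poly q t = poly p t"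
    using V.joined[OF ab(3,4)] unfolding joined_by_rational_curve_def by blast
  obtain M C where M: "finite C" "(0::complex) \<notin> C" "1 \<notin> C"
    "M 0 = y" "M 1 = y'" "\<And>t. t \<notin> C \<Longrightarrow> M t \<in> points W"
    "\<forall>f\<in>coord_ring W. \<exists>p q. \<forall>t. t \<notin> C \<longrightarrow> poly q t \<noteq> 0 \<and> f (M t) * poly q t = poly p t"
    using W.joined[OF ab(5,6)] unfolding joined_by_rational_curve_def by blast
  have "\<exists>p q. \<forall>t. t \<notin> B \<union> C \<longrightarrow> poly q t \<noteq> 0 \<and> f (L t, M t) * poly q t = poly p t"
    if "f \<in> coord_ring (V \<times>\<^sub>v W)" for f
  proof (rule rational_restriction_generated[where L = "\<lambda>t. (L t, M t)"])
    show "f \<in> generated_algebra ((\<lambda>f. f \<circ> fst) ` coord_ring V \<union> (\<lambda>g. g \<circ> snd) ` coord_ring W)"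
      using that by (simp add: prod_variety_def)
  next
    fix g assume "g \<in> (\<lambda>f. f \<circ> fst) ` coord_ring V \<union> (\<lambda>g. g \<circ> snd) ` coord_ring W"
    then show "\<exists>p q. \<forall>t. t \<notin> B \<union> C \<longrightarrow> poly q t \<noteq> 0 \<and> g (L t, M t) * poly q t = poly p t"
      using L(7) M(7) by fastforce
  qed
  then show "joined_by_rational_curve (V \<times>\<^sub>v W) a b"
    unfolding joined_by_rational_curve_def
    by (intro exI[of _ "\<lambda>t. (L t, M t)"] exI[of _ "B \<union> C"])
       (use L M ab in \<open>auto simp: prod_variety_def\<close>)
qed

lemma points_prod [simp]: "points (V \<times>\<^sub>v W) = points V \<times> points W"
  by (simp add: prod_variety_def)

lemma prod_ring_fst: "f \<in> coord_ring V \<Longrightarrow> (\<lambda>z. f (fst z)) \<in> coord_ring (V \<times>\<^sub>v W)"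
  unfolding prod_variety_def by (auto intro!: generated_algebra.gen simp: comp_def image_iff)

lemma prod_ring_snd: "g \<in> coord_ring W \<Longrightarrow> (\<lambda>z. g (snd z)) \<in> coord_ring (V \<times>\<^sub>v W)"
  unfolding prod_variety_def by (auto intro!: generated_algebra.gen simp: comp_def image_iff)

lemma points_Gm [simp]: "points Gm = - {0}"
  by (simp add: Gm_def)

lemma Gm_ring: "(\<lambda>c. c) \<in> coord_ring Gm"
  by (auto simp: Gm_def intro: generated_algebra.gen)

lemma curve_connected_Gm: "curve_connected_variety Gm"
proof
  show "generated_algebra (coord_ring Gm) = coord_ring Gm" by (simp add: Gm_def)
  fix x y :: complex assume xy: "x \<in> points Gm" "y \<in> points Gm"
  define L where "L = (\<lambda>t. poly [:x, y - x:] t)"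
  define B where "B = {t. L t = 0}"
  have "\<exists>p q. \<forall>t. t \<notin> B \<longrightarrow> poly q t \<noteq> 0 \<and> f (L t) * poly q t = poly p t"
    if "f \<in> coord_ring Gm" for f
  proof (rule rational_restriction_generated[where L = L])
    show "f \<in> generated_algebra {\<lambda>c. c, inverse}" using that by (simp add: Gm_def)
  next
    fix g :: "complex \<Rightarrow> complex" assume "g \<in> {\<lambda>c. c, inverse}"
    then show "\<exists>p q. \<forall>t. t \<notin> B \<longrightarrow> poly q t \<noteq> 0 \<and> g (L t) * poly q t = poly p t"
    proof (elim insertE emptyE)
      assume "g = (\<lambda>c. c)"
      then show ?thesis by (intro exI[of _ "[:x, y - x:]"] exI[of _ 1]) (simp add: L_def)
    next
      assume "g = inverse"
      then show ?thesis by (intro exI[of _ 1] exI[of _ "[:x, y - x:]"]) (auto simp: L_def B_def)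
    qed
  qed
  moreover have "finite B"
    unfolding B_def L_def using xy by (intro poly_roots_finite) auto
  ultimately show "joined_by_rational_curve Gm x y"
    unfolding joined_by_rational_curve_def
    by (intro exI[of _ L] exI[of _ B]) (use xy in \<open>auto simp: L_def B_def\<close>)
qed


section \<open>The unipotent loop group as a group of periodic matrices\<close>

lemma periodic_shift:
  assumes "\<And>r s. Y (r + int n) (s + int n) = (Y r s :: complex)"
  shows "Y (r + a * int n) (s + a * int n) = Y r s"
proof (induction a rule: int_induct[where k = 0])
  case (step1 i)
  then show ?case using assms[of "r + i * int n" "s + i * int n"] by (simp add: algebra_simps)
next
  case (step2 i)
  then show ?case using assms[of "r + (i - 1) * int n" "s + (i - 1) * int n"] by (simp add: algebra_simps)
qed simp

text \<open>Taking constant terms is a ring homomorphism, so the determinant is a power series with constant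
  coefficient 1; in particular it is nonzero, hence a unit in the field of Laurent series.\<close>

lemma unitriangular_constant_term_invertible:
  fixes P :: "complex fps mat"
  assumes P: "P \<in> carrier_mat n n"
    and diag: "\<And>i. i < n \<Longrightarrow> fps_nth (P $$ (i, i)) 0 = 1"
    and lower: "\<And>i j. j < i \<Longrightarrow> i < n \<Longrightarrow> fps_nth (P $$ (i, j)) 0 = 0"
  shows "invertible_mat (map_mat fps_to_fls P)"
proof -
  interpret const: comm_ring_hom "\<lambda>f :: complex fps. fps_nth f 0"
    by unfold_locales auto
  interpret laurent: comm_ring_hom "fps_to_fls :: complex fps \<Rightarrow> complex fls"
    by unfold_locales (auto simp: fls_times_fps_to_fls)
  let ?C = "map_mat (\<lambda>f. fps_nth f 0) P"
  have C: "?C \<in> carrier_mat n n" using P by simp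
  have "upper_triangular ?C"
    unfolding upper_triangular_def using P lower by auto
  then have "det ?C = prod_list (diag_mat ?C)" using C by (rule det_upper_triangular)
  also have "diag_mat ?C = map (\<lambda>_. 1) [0..<n]"
    unfolding diag_mat_def using P diag by auto
  finally have "fps_nth (det P) 0 = 1"
    by (simp add: map_replicate_const)
  then have "det P \<noteq> 0" by auto
  then have nz: "det (map_mat fps_to_fls P) \<noteq> 0" by simp
  have M: "map_mat fps_to_fls P \<in> carrier_mat n n" using P by simp
  from det_non_zero_imp_unit[OF M nz, unfolded Units_def, of "()"]
  obtain B where "B \<in> carrier_mat n n" "B * map_mat fps_to_fls P = 1\<^sub>m n"
    "map_mat fps_to_fls P * B = 1\<^sub>m n"
    by (auto simp: ring_mat_def)
  then show ?thesis
    unfolding invertible_mat_def inverts_mat_def using M by auto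
qed

text \<open>The essential part is that a periodic unitriangular \<open>Y\<close> comes from an invertible loop. Below the
  diagonal blocks \<open>Y\<close> vanishes, so its loop is a matrix of power series, with constant term the
  diagonal block, which is unitriangular.\<close>

lemma unipotent_loop_group_iff:
  assumes "n > 0"
  shows "Y \<in> unipotent_loop_group n \<longleftrightarrow>
    (\<forall>r s. Y (r + int n) (s + int n) = Y r s) \<and> (\<forall>r. Y r r = 1) \<and> (\<forall>r s. s < r \<longrightarrow> Y r s = 0)"
    (is "_ \<longleftrightarrow> ?R")
proof
  assume "Y \<in> unipotent_loop_group n"
  moreover have "periodic_matrix n g (r + int n) (s + int n) = periodic_matrix n g r s" for g r s
    using assms div_add_self2[of "int n" "r - 1"] div_add_self2[of "int n" "s - 1"]
      mod_add_self2[of "r - 1" "int n"] mod_add_self2[of "s - 1" "int n"]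
    unfolding periodic_matrix_def by (simp add: algebra_simps)
  ultimately show ?R unfolding unipotent_loop_group_def by auto
next
  assume R: ?R
  define P where "P = mat n n (\<lambda>(i, j). Abs_fps (\<lambda>k. Y (1 + int i) (1 + int j + int k * int n)))"
  define g where "g = map_mat fps_to_fls P"
  have "invertible_mat g" unfolding g_def
    by (rule unitriangular_constant_term_invertible[where n = n]) (use R in \<open>auto simp: P_def\<close>)
  then have "g \<in> loop_group n" unfolding loop_group_def by (auto simp: g_def P_def)
  moreover have "periodic_matrix n g = Y"
  proof (intro ext)
    fix r s
    \<comment> \<open>Rows and columns of the loop are numbered from 0, those of blocks of \<open>Y\<close> from 1.\<close>
    define i j a b where ij: "i = (r - 1) mod int n" "j = (s - 1) mod int n"
      "a = (r - 1) div int n" "b = (s - 1) div int n"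
    have rs: "r = 1 + i + a * int n" "s = 1 + j + b * int n"
      unfolding ij by (metis add.commute add.left_commute diff_add_cancel div_mult_mod_eq)+
    have bounds: "0 \<le> i" "i < int n" "0 \<le> j" "j < int n" unfolding ij using assms by auto
    have lhs: "periodic_matrix n g r s = (if b - a < 0 then 0 else Y (1 + i) (1 + j + (b - a) * int n))"
      unfolding periodic_matrix_def ij[symmetric] g_def P_def using bounds by (auto simp: nat_less_iff)
    show "periodic_matrix n g r s = Y r s"
    proof (cases "b < a")
      case True
      then have "(b + 1) * int n \<le> a * int n" by (intro mult_right_mono) auto
      then have "s < r" using rs bounds by (simp add: algebra_simps)
      then show ?thesis using lhs True R by simp
    next
      case False
      have "Y r s = Y (1 + i + a * int n) (1 + j + (b - a) * int n + a * int n)"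
        using rs by (simp add: algebra_simps)
      also have "\<dots> = Y (1 + i) (1 + j + (b - a) * int n)"
        by (rule periodic_shift) (use R in auto)
      finally show ?thesis using lhs False by simp
    qed
  qed
  ultimately show "Y \<in> unipotent_loop_group n"
    unfolding unipotent_loop_group_def using R by blast
qed

lemma periodic_entry:
  assumes "Y \<in> unipotent_loop_group n" "n > 0" "int n dvd r' - r" "s' - s = r' - r"
  shows "Y r' s' = Y r s"
proof -
  obtain a where "r' - r = int n * a" using assms(3) by blast
  then have "r' = r + a * int n" "s' = s + a * int n" using assms(4) by (auto simp: algebra_simps)
  then show ?thesis
    using periodic_shift[of Y n r a s] assms(1) unipotent_loop_group_iff[OF assms(2)] by simp
qed

section \<open>Row and column operations\<close>

definition row_add :: "nat \<Rightarrow> int \<Rightarrow> complex \<Rightarrow> inf_matrix \<Rightarrow> inf_matrix" where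
  "row_add n k a Y = (\<lambda>r s. Y r s + (if int n dvd r - k then a * Y (r + 1) s else 0))"

definition col_add :: "nat \<Rightarrow> int \<Rightarrow> complex \<Rightarrow> inf_matrix \<Rightarrow> inf_matrix" where
  "col_add n l b Y = (\<lambda>r s. Y r s + (if int n dvd s - 1 - l then b * Y r (s - 1) else 0))"

lemma chevalley_mult_left: "chevalley n k a \<otimes>\<^sub>m Y = row_add n k a Y"
proof (intro ext)
  fix r s
  have "(chevalley n k a \<otimes>\<^sub>m Y) r s = (\<Sum>t\<in>{r, r + 1}. chevalley n k a r t * Y t s)"
    unfolding inf_mult_def by (rule sum.mono_neutral_left) (auto simp: chevalley_def split: if_splits)
  then show "(chevalley n k a \<otimes>\<^sub>m Y) r s = row_add n k a Y r s"
    by (simp add: chevalley_def row_add_def cong_iff_dvd_diff)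
qed

lemma chevalley_mult_right: "Y \<otimes>\<^sub>m chevalley n l b = col_add n l b Y"
proof (intro ext)
  fix r s
  have "(Y \<otimes>\<^sub>m chevalley n l b) r s = (\<Sum>t\<in>{s, s - 1}. Y r t * chevalley n l b t s)"
    unfolding inf_mult_def by (rule sum.mono_neutral_left) (auto simp: chevalley_def split: if_splits)
  then show "(Y \<otimes>\<^sub>m chevalley n l b) r s = col_add n l b Y r s"
    by (simp add: chevalley_def col_add_def cong_iff_dvd_diff)
qed

lemma row_add_zero [simp]: "row_add n k 0 Y = Y"
  and col_add_zero [simp]: "col_add n l 0 Y = Y"
  by (intro ext; simp add: row_add_def col_add_def)+

lemma row_col_commute: "row_add n k a (col_add n l b Y) = col_add n l b (row_add n k a Y)"
  by (intro ext) (simp add: row_add_def col_add_def algebra_simps)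

lemma dvd_offset: "int n dvd x \<Longrightarrow> w - x = d \<Longrightarrow> int n dvd w \<longleftrightarrow> int n dvd d"
  using dvd_add_right_iff[of "int n" x d] by (simp add: algebra_simps)

lemma dvd_shift:
  assumes "int n dvd x - y"
  shows "int n dvd x - z \<longleftrightarrow> int n dvd y - z"
  using dvd_add_left_iff[OF assms, of "y - z"] by simp

lemma row_add_row_add:
  assumes "n > 1"
  shows "row_add n k a (row_add n k b Y) = row_add n k (a + b) Y"
proof (intro ext)
  fix r s
  have "\<not> int n dvd r + 1 - k" if "int n dvd r - k"
    using dvd_add_right_iff[OF that, of 1] assms by (simp add: algebra_simps)
  then show "row_add n k a (row_add n k b Y) r s = row_add n k (a + b) Y r s"
    by (auto simp: row_add_def algebra_simps)
qed

lemma col_add_col_add: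
  assumes "n > 1"
  shows "col_add n l a (col_add n l b Y) = col_add n l (a + b) Y"
proof (intro ext)
  fix r s
  have "\<not> int n dvd s - 1 - 1 - l" if "int n dvd s - 1 - l"
    using dvd_add_right_iff[OF that, of "-1"] assms by (simp add: algebra_simps)
  then show "col_add n l a (col_add n l b Y) r s = col_add n l (a + b) Y r s"
    by (auto simp: col_add_def algebra_simps)
qed

lemma row_add_commute:
  assumes "\<not> int n dvd i - j - 1" "\<not> int n dvd i - j + 1"
  shows "row_add n i a (row_add n j b Y) = row_add n j b (row_add n i a Y)"
proof (intro ext)
  fix r s
  have "\<not> int n dvd r + 1 - j" if "int n dvd r - i"
    using dvd_shift[OF that, of "j - 1"] assms(2) by (simp add: algebra_simps)
  moreover have "\<not> int n dvd r + 1 - i" if "int n dvd r - j"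
  proof
    assume "int n dvd r + 1 - i"
    from dvd_diff[OF that this] show False using assms(1) by (simp add: algebra_simps)
  qed
  ultimately show "row_add n i a (row_add n j b Y) r s = row_add n j b (row_add n i a Y) r s"
    by (auto simp: row_add_def algebra_simps)
qed

lemma col_add_commute:
  assumes "\<not> int n dvd i - j - 1" "\<not> int n dvd i - j + 1"
  shows "col_add n i a (col_add n j b Y) = col_add n j b (col_add n i a Y)"
proof (intro ext)
  fix r s
  have "\<not> int n dvd s - 1 - 1 - j" if "int n dvd s - 1 - i"
    using dvd_shift[OF that, of "j + 1"] assms(1) by (simp add: algebra_simps)
  moreover have "\<not> int n dvd s - 1 - 1 - i" if "int n dvd s - 1 - j"
  proof
    assume "int n dvd s - 1 - 1 - i"
    from dvd_diff[OF that this] show False using assms(2) by (simp add: algebra_simps)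
  qed
  ultimately show "col_add n i a (col_add n j b Y) r s = col_add n j b (col_add n i a Y) r s"
    by (auto simp: col_add_def algebra_simps)
qed

lemma not_dvd_small: "n > 2 \<Longrightarrow> \<not> int n dvd 2" "n > 2 \<Longrightarrow> \<not> int n dvd - 2"
  by (auto dest: zdvd_imp_le)

text \<open>The relation between products of three elementary matrices in the group of unitriangular
  \<open>3 \<times> 3\<close> matrices. For \<open>n > 2\<close> the three rows \<open>i, i + 1, i + 2\<close> are in different residue classes.\<close>

lemma row_add_braid:
  assumes n: "n > 2" and "a\<^sub>1 + a\<^sub>3 = b\<^sub>2" "a\<^sub>2 = b\<^sub>1 + b\<^sub>3" "a\<^sub>3 * a\<^sub>2 = b\<^sub>2 * b\<^sub>1"
  shows "row_add n i a\<^sub>3 (row_add n (i + 1) a\<^sub>2 (row_add n i a\<^sub>1 Y)) =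
         row_add n (i + 1) b\<^sub>3 (row_add n i b\<^sub>2 (row_add n (i + 1) b\<^sub>1 Y))"
proof (intro ext)
  fix r s
  consider (fst) "int n dvd r - i" | (snd) "int n dvd r - (i + 1)"
    | (none) "\<not> int n dvd r - i" "\<not> int n dvd r - (i + 1)" by blast
  then show "row_add n i a\<^sub>3 (row_add n (i + 1) a\<^sub>2 (row_add n i a\<^sub>1 Y)) r s =
    row_add n (i + 1) b\<^sub>3 (row_add n i b\<^sub>2 (row_add n (i + 1) b\<^sub>1 Y)) r s"
  proof cases
    case fst
    have "\<not> int n dvd r - (i + 1)" "\<not> int n dvd r + 1 - i" "\<not> int n dvd 2 + r - i"
      using dvd_offset[OF fst, of "r - (i + 1)" "-1"] dvd_offset[OF fst, of "r + 1 - i" 1]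
        dvd_offset[OF fst, of "2 + r - i" 2] n not_dvd_small[OF n] by auto
    moreover have "a\<^sub>1 * y + a\<^sub>3 * (y + a\<^sub>2 * z) = b\<^sub>2 * (y + b\<^sub>1 * z)" for y z
    proof -
      have "a\<^sub>1 * y + a\<^sub>3 * (y + a\<^sub>2 * z) = (a\<^sub>1 + a\<^sub>3) * y + (a\<^sub>3 * a\<^sub>2) * z"
        by (simp add: algebra_simps)
      then show ?thesis unfolding assms(2,4) by (simp add: algebra_simps)
    qed
    ultimately show ?thesis
      using fst by (simp add: row_add_def)
  next
    case snd
    have "\<not> int n dvd r - i" "\<not> int n dvd r + 1 - i"
      using dvd_offset[OF snd, of "r - i" 1] dvd_offset[OF snd, of "r + 1 - i" 2]
        n not_dvd_small[OF n] by auto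
    then show ?thesis
      using snd assms(3) by (simp add: row_add_def distrib_right)
  next
    case none
    then show ?thesis by (simp add: row_add_def)
  qed
qed

lemma col_add_braid:
  assumes n: "n > 2" and "a\<^sub>1 + a\<^sub>3 = b\<^sub>2" "a\<^sub>2 = b\<^sub>1 + b\<^sub>3" "a\<^sub>2 * a\<^sub>1 = b\<^sub>3 * b\<^sub>2"
  shows "col_add n l a\<^sub>3 (col_add n (l + 1) a\<^sub>2 (col_add n l a\<^sub>1 Y)) =
         col_add n (l + 1) b\<^sub>3 (col_add n l b\<^sub>2 (col_add n (l + 1) b\<^sub>1 Y))"
proof (intro ext)
  fix r s
  consider (fst) "int n dvd s - 1 - l" | (snd) "int n dvd s - 1 - (l + 1)"
    | (none) "\<not> int n dvd s - 1 - l" "\<not> int n dvd s - 1 - (l + 1)" by blast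
  then show "col_add n l a\<^sub>3 (col_add n (l + 1) a\<^sub>2 (col_add n l a\<^sub>1 Y)) r s =
    col_add n (l + 1) b\<^sub>3 (col_add n l b\<^sub>2 (col_add n (l + 1) b\<^sub>1 Y)) r s"
  proof cases
    case fst
    have "\<not> int n dvd s - 1 - (l + 1)" "\<not> int n dvd s - 1 - 1 - l" "\<not> int n dvd s - 1 - 1 - (l + 1)"
      using dvd_offset[OF fst, of "s - 1 - (l + 1)" "-1"] dvd_offset[OF fst, of "s - 1 - 1 - l" "-1"]
        dvd_offset[OF fst, of "s - 1 - 1 - (l + 1)" "-2"] n not_dvd_small[OF n] by auto
    then show ?thesis
      using fst assms(2) by (simp add: col_add_def flip: distrib_right)
  next
    case snd
    have "\<not> int n dvd s - 1 - l" "int n dvd s - 1 - 1 - l" "\<not> int n dvd s - 1 - 1 - (l + 1)"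
      "\<not> int n dvd s - 1 - 1 - 1 - l" "\<not> int n dvd s - 1 - 1 - 1 - (l + 1)"
      using dvd_offset[OF snd, of "s - 1 - l" 1] dvd_offset[OF snd, of "s - 1 - 1 - l" 0]
        dvd_offset[OF snd, of "s - 1 - 1 - (l + 1)" "-1"]
        dvd_offset[OF snd, of "s - 1 - 1 - 1 - l" "-1"]
        dvd_offset[OF snd, of "s - 1 - 1 - 1 - (l + 1)" "-2"] n not_dvd_small[OF n] by auto
    moreover have "a\<^sub>2 * (y + a\<^sub>1 * z) = b\<^sub>1 * y + b\<^sub>3 * (y + b\<^sub>2 * z)" for y z
    proof -
      have "a\<^sub>2 * (y + a\<^sub>1 * z) = a\<^sub>2 * y + (a\<^sub>2 * a\<^sub>1) * z" by (simp add: algebra_simps)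
      then show ?thesis unfolding assms(4) unfolding assms(3) by (simp add: algebra_simps)
    qed
    ultimately show ?thesis
      using snd by (simp add: col_add_def)
  next
    case none
    then show ?thesis by (simp add: col_add_def)
  qed
qed

lemma row_add_unipotent:
  assumes "n > 0" "Y \<in> unipotent_loop_group n"
  shows "row_add n k a Y \<in> unipotent_loop_group n"
proof -
  have "int n dvd r + int n - k \<longleftrightarrow> int n dvd r - k" for r
    using dvd_shift[of n "r + int n" r k] by simp
  moreover have "Y (r + int n + 1) (s + int n) = Y (r + 1) s" for r s
    by (rule periodic_entry) (use assms in auto)
  ultimately show ?thesis
    using assms(2) unfolding unipotent_loop_group_iff[OF assms(1)] row_add_def by simp
qed

lemma col_add_unipotent:
  assumes "n > 0" "Y \<in> unipotent_loop_group n"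
  shows "col_add n l b Y \<in> unipotent_loop_group n"
proof -
  have "int n dvd s + int n - 1 - l \<longleftrightarrow> int n dvd s - 1 - l" for s
    using dvd_shift[of n "s + int n - 1" "s - 1" l] by simp
  moreover have "Y (r + int n) (s + int n - 1) = Y r (s - 1)" for r s
    by (rule periodic_entry) (use assms in auto)
  ultimately show ?thesis
    using assms(2) unfolding unipotent_loop_group_iff[OF assms(1)] col_add_def by simp
qed


section \<open>The crystal operators\<close>

text \<open>The total function underlying \<open>e\<^sub>k\<^sup>c\<close>; where the pivot vanishes its value is meaningless. Being
  total, it can be composed before it is known where the composition is defined.\<close>

definition crystal_step :: "nat \<Rightarrow> nat \<Rightarrow> int \<Rightarrow> complex \<Rightarrow> inf_matrix \<Rightarrow> inf_matrix" where
  "crystal_step n m k c Y =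
     col_add n (k + int m) ((inverse c - 1) * (Y (k + 1) (k + int m + 1) / Y (k + 1) (k + int m)))
      (row_add n k ((c - 1) * (Y k (k + int m) / Y (k + 1) (k + int m))) Y)"

lemma U_e_eq_crystal_step:
  "U_e n m k c Y = (if Y \<in> unipotent_loop_group n \<and> Y (k + 1) (k + int m) \<noteq> 0 \<and> c \<noteq> 0
     then Some (crystal_step n m k c Y) else None)"
  by (simp add: U_e_def U_phi_def U_eps_def crystal_step_def chevalley_mult_left
      chevalley_mult_right restrict_map_def)

lemma crystal_step_one [simp]: "crystal_step n m k 1 Y = Y"
  by (simp add: crystal_step_def)

lemma crystal_step_unipotent:
  "n > 0 \<Longrightarrow> Y \<in> unipotent_loop_group n \<Longrightarrow> crystal_step n m k c Y \<in> unipotent_loop_group n"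
  unfolding crystal_step_def by (intro col_add_unipotent row_add_unipotent)

lemma crystal_step_unaffected:
  assumes "\<not> int n dvd r - k" "\<not> int n dvd s - 1 - (k + int m)"
  shows "crystal_step n m k c Y r s = Y r s"
  using assms by (simp add: crystal_step_def row_add_def col_add_def)

lemma crystal_step_periodic:
  assumes "n > 0" "Y \<in> unipotent_loop_group n" "int n dvd k' - k"
  shows "crystal_step n m k' c Y = crystal_step n m k c Y"
proof -
  have entry: "Y (k' + a) (k' + int m + b) = Y (k + a) (k + int m + b)" for a b
    by (rule periodic_entry) (use assms in auto)
  have dvd: "int n dvd x - k' \<longleftrightarrow> int n dvd x - k" for x
    using dvd_add_left_iff[OF assms(3), of "x - k'"] by simp
  have "row_add n k' a Y = row_add n k a Y" for a Y
    by (simp add: row_add_def dvd)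
  moreover have "int n dvd s - 1 - (k' + int m) \<longleftrightarrow> int n dvd s - 1 - (k + int m)" for s
    using dvd[of "s - 1 - int m"] by (simp add: algebra_simps)
  then have "col_add n (k' + int m) a Y = col_add n (k + int m) a Y" for a Y
    unfolding col_add_def by simp
  ultimately show ?thesis
    unfolding crystal_step_def using entry[of 1 0] entry[of 1 1] entry[of 0 0] by simp
qed

context
  fixes n m :: nat
  assumes n: "n > 1"
begin

lemma crystal_step_pivot: "crystal_step n m k c Y (k + 1) (k + int m) = Y (k + 1) (k + int m)"
  using n by (simp add: crystal_step_def row_add_def col_add_def)

lemma crystal_step_below_pivot:
  "c \<noteq> 0 \<Longrightarrow> Y (k + 1) (k + int m) \<noteq> 0 \<Longrightarrow>
   crystal_step n m k c Y (k + 1) (k + int m + 1) = inverse c * Y (k + 1) (k + int m + 1)"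
  using n by (simp add: crystal_step_def row_add_def col_add_def field_simps)

lemma crystal_step_above_pivot:
  "Y (k + 1) (k + int m) \<noteq> 0 \<Longrightarrow>
   crystal_step n m k c Y k (k + int m) = c * Y k (k + int m)"
  using n by (simp add: crystal_step_def row_add_def col_add_def field_simps)

text \<open>The second step meets the same pivot and neighbours scaled by \<open>c'\<close>; its coefficients therefore
  telescope with those of the first, as in \<open>(c - 1) c' + (c' - 1) = c c' - 1\<close>.\<close>

lemma crystal_step_mult:
  assumes "c \<noteq> 0" "c' \<noteq> 0" "Y (k + 1) (k + int m) \<noteq> 0"
  shows "crystal_step n m k c (crystal_step n m k c' Y) = crystal_step n m k (c * c') Y"
proof -
  define p q where pq: "p = Y k (k + int m) / Y (k + 1) (k + int m)"
    "q = Y (k + 1) (k + int m + 1) / Y (k + 1) (k + int m)"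
  have "crystal_step n m k c (crystal_step n m k c' Y) =
     col_add n (k + int m) ((inverse c - 1) * (inverse c' * q))
      (row_add n k ((c - 1) * (c' * p)) (crystal_step n m k c' Y))"
    unfolding crystal_step_def[of n m k c] crystal_step_pivot pq
    using assms by (simp add: crystal_step_above_pivot crystal_step_below_pivot)
  also have "\<dots> = col_add n (k + int m) ((inverse c - 1) * (inverse c' * q) + (inverse c' - 1) * q)
      (row_add n k ((c - 1) * (c' * p) + (c' - 1) * p) Y)"
    unfolding crystal_step_def pq[symmetric] row_col_commute row_add_row_add[OF n] col_add_col_add[OF n] ..
  also have "(inverse c - 1) * (inverse c' * q) + (inverse c' - 1) * q = (inverse (c * c') - 1) * q"
    by (simp add: algebra_simps)
  also have "(c - 1) * (c' * p) + (c' - 1) * p = (c * c' - 1) * p"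
    by (simp add: algebra_simps)
  finally show ?thesis unfolding pq crystal_step_def .
qed

text \<open>Since \<open>\<gamma>\<^sub>j\<close> is a quotient of consecutive entries of this superdiagonal, its weight is the
  difference of two consecutive exponents.\<close>

lemma crystal_step_superdiagonal:
  assumes "Y \<in> unipotent_loop_group n" "c \<noteq> 0" "Y (k + 1) (k + int m) \<noteq> 0"
  shows "crystal_step n m k c Y j (j + int m) =
    c powi (of_bool (int n dvd j - k) - of_bool (int n dvd j - 1 - k)) * Y j (j + int m)"
proof -
  have U: "crystal_step n m k c Y \<in> unipotent_loop_group n"
    using assms n by (simp add: crystal_step_unipotent)
  consider (same) "int n dvd j - k" | (succ) "int n dvd j - 1 - k"
    | (other) "\<not> int n dvd j - k" "\<not> int n dvd j - 1 - k" by blast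
  then show ?thesis
  proof cases
    case same
    then have "\<not> int n dvd j - 1 - k"
      using dvd_offset[OF same, of "j - 1 - k" "-1"] n by simp
    moreover have entry: "Z j (j + int m) = Z k (k + int m)" if "Z \<in> unipotent_loop_group n" for Z
      by (rule periodic_entry) (use that same n in auto)
    ultimately show ?thesis
      using same crystal_step_above_pivot[where Y = Y] assms(3)
      unfolding entry[OF U] entry[OF assms(1)] by simp
  next
    case succ
    then have "\<not> int n dvd j - k"
      using dvd_offset[OF succ, of "j - k" "1"] n by simp
    moreover have entry: "Z j (j + int m) = Z (k + 1) (k + int m + 1)" if "Z \<in> unipotent_loop_group n" for Z
      by (rule periodic_entry) (use that succ n in \<open>auto simp: algebra_simps\<close>)
    ultimately show ?thesis
      using succ crystal_step_below_pivot[where Y = Y] assms(2,3)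
      unfolding entry[OF U] entry[OF assms(1)] by (simp add: power_int_minus)
  next
    case other
    then show ?thesis
      using crystal_step_unaffected[of n j k "j + int m" m c Y] by (simp add: algebra_simps)
  qed
qed

text \<open>Written this way, the case \<open>n = 2\<close> is not special: both neighbours of \<open>j\<close> coincide and contribute
  \<open>-2\<close> together.\<close>

lemma cartan_eq:
  "cartan n k j = 2 * of_bool (int n dvd j - k) - of_bool (int n dvd j - 1 - k) - of_bool (int n dvd j + 1 - k)"
proof -
  have eq: "[k = j] (mod int n) \<longleftrightarrow> int n dvd j - k" "[k - j = 1] (mod int n) \<longleftrightarrow> int n dvd j + 1 - k"
    "[k - j = -1] (mod int n) \<longleftrightarrow> int n dvd j - 1 - k"
    using dvd_diff_commute[of "int n" k j] dvd_diff_commute[of "int n" k "1 + j"]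
      dvd_diff_commute[of "int n" "1 + k" j]
    by (simp_all add: cong_iff_dvd_diff algebra_simps)
  have same: "\<not> int n dvd j - 1 - k \<and> \<not> int n dvd j + 1 - k" if "int n dvd j - k"
    using dvd_offset[OF that, of "j - 1 - k" "-1"] dvd_offset[OF that, of "j + 1 - k" 1] n by simp
  have diff: "int n dvd j - 1 - k \<longleftrightarrow> int n dvd j + 1 - k" if "n = 2"
    using that dvd_add_right_iff[of "2::int" 2 "j - 1 - k"] by (simp add: algebra_simps)
  have pair: "int n dvd j - 1 - k" if "n = 2" "\<not> int n dvd j - k"
    using that by simp
  have notboth: "\<not> int n dvd j + 1 - k" if "n \<noteq> 2" "int n dvd j - 1 - k"
    using dvd_offset[OF that(2), of "j + 1 - k" 2] not_dvd_small[of n] n that(1) by simp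
  show ?thesis
    unfolding cartan_def eq using same diff pair notboth by auto
qed

text \<open>Neither operator changes the three entries that determine the other one, so on both sides the
  same commuting row and column operations are performed.\<close>

lemma crystal_step_commute:
  assumes "\<not> int n dvd i - j" "\<not> int n dvd i - j - 1" "\<not> int n dvd i - j + 1"
  shows "crystal_step n m i c (crystal_step n m j c' Y) = crystal_step n m j c' (crystal_step n m i c Y)"
proof -
  have sym: "\<not> int n dvd j - i" "\<not> int n dvd j - i - 1" "\<not> int n dvd j - i + 1"
    using assms dvd_minus_iff[of "int n" "i - j"] dvd_minus_iff[of "int n" "i - j + 1"]
      dvd_minus_iff[of "int n" "i - j - 1"] by (simp_all add: algebra_simps)
  have unaffected: "crystal_step n m b c Y a (a + int m) = Y a (a + int m)"
    "crystal_step n m b c Y (a + 1) (a + int m) = Y (a + 1) (a + int m)"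
    "crystal_step n m b c Y (a + 1) (a + int m + 1) = Y (a + 1) (a + int m + 1)"
    if "\<not> int n dvd a - b" "\<not> int n dvd a - b - 1" "\<not> int n dvd a - b + 1" for a b c Y
    by (rule crystal_step_unaffected; use that in \<open>simp add: algebra_simps\<close>)+
  have rows: "row_add n i a (row_add n j b Z) = row_add n j b (row_add n i a Z)" for a b Z
    by (rule row_add_commute) (use assms in auto)
  have cols: "col_add n (i + int m) a (col_add n (j + int m) b Z) =
      col_add n (j + int m) b (col_add n (i + int m) a Z)" for a b Z
    by (rule col_add_commute) (use assms in auto)
  show ?thesis
    unfolding crystal_step_def[of n m i c "crystal_step n m j c' Y"]
      crystal_step_def[of n m j c' "crystal_step n m i c Y"]
      unaffected[OF assms] unaffected[OF sym]
    unfolding crystal_step_def[of n m i c Y] crystal_step_def[of n m j c' Y] row_col_commute rows cols ..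
qed

end

text \<open>Each side consists of three row and three column operations, and rows commute with columns. By
  the relation for elementary matrices it suffices to compare coefficients. They depend on the
  two pivots \<open>p\<close> and \<open>q\<close>, the entry \<open>w\<close> through which one operator moves the pivot of the other,
  and the neighbours \<open>A\<close>, \<open>B\<close>, \<open>D\<close> of the pivots.\<close>

lemma crystal_step_braid:
  assumes n: "n > 2" and c: "c \<noteq> 0" "c' \<noteq> 0"
    and L: "Y (i + 1) (i + int m) \<noteq> 0"
      "crystal_step n m i c' Y (i + 2) (i + int m + 1) \<noteq> 0"
      "crystal_step n m (i + 1) (c * c') (crystal_step n m i c' Y) (i + 1) (i + int m) \<noteq> 0"
    and R: "Y (i + 2) (i + int m + 1) \<noteq> 0"
      "crystal_step n m (i + 1) c Y (i + 1) (i + int m) \<noteq> 0"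
      "crystal_step n m i (c * c') (crystal_step n m (i + 1) c Y) (i + 2) (i + int m + 1) \<noteq> 0"
  shows "crystal_step n m i c (crystal_step n m (i + 1) (c * c') (crystal_step n m i c' Y)) =
    crystal_step n m (i + 1) c' (crystal_step n m i (c * c') (crystal_step n m (i + 1) c Y))"
proof -
  have n1: "n > 1" using n by simp
  note small = not_dvd_small[OF n]
  define A p B q D w where entries: "A = Y i (i + int m)" "p = Y (i + 1) (i + int m)"
    "B = Y (i + 1) (i + int m + 1)" "q = Y (i + 2) (i + int m + 1)"
    "D = Y (i + 2) (i + int m + 2)" "w = Y (i + 2) (i + int m)"
  have at: "crystal_step n m i x Z = col_add n (i + int m) ((inverse x - 1) * (Z (i + 1) (i + int m + 1) / Z (i + 1) (i + int m)))
      (row_add n i ((x - 1) * (Z i (i + int m) / Z (i + 1) (i + int m))) Z)"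
    "crystal_step n m (i + 1) x Z = col_add n (i + int m + 1) ((inverse x - 1) * (Z (i + 2) (i + int m + 2) / Z (i + 2) (i + int m + 1)))
      (row_add n (i + 1) ((x - 1) * (Z (i + 1) (i + int m + 1) / Z (i + 2) (i + int m + 1))) Z)" for x Z
    by (simp_all add: crystal_step_def algebra_simps)
  \<comment> \<open>The six positions are closed under both operators: no further entry enters.\<close>
  have at_i: "crystal_step n m i x Z i (i + int m) = x * Z i (i + int m)"
    "crystal_step n m i x Z (i + 1) (i + int m) = Z (i + 1) (i + int m)"
    "crystal_step n m i x Z (i + 1) (i + int m + 1) = Z (i + 1) (i + int m + 1) / x"
    "crystal_step n m i x Z (i + 2) (i + int m + 1) = Z (i + 2) (i + int m + 1) +
       (inverse x - 1) * Z (i + 1) (i + int m + 1) / Z (i + 1) (i + int m) * Z (i + 2) (i + int m)"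
    "crystal_step n m i x Z (i + 2) (i + int m + 2) = Z (i + 2) (i + int m + 2)"
    "crystal_step n m i x Z (i + 2) (i + int m) = Z (i + 2) (i + int m)"
    if "x \<noteq> 0" "Z (i + 1) (i + int m) \<noteq> 0" for x Z
    unfolding at using that n small by (simp_all add: row_add_def col_add_def field_simps)
  have at_i1: "crystal_step n m (i + 1) x Z i (i + int m) = Z i (i + int m)"
    "crystal_step n m (i + 1) x Z (i + 1) (i + int m) = Z (i + 1) (i + int m) +
       (x - 1) * Z (i + 1) (i + int m + 1) / Z (i + 2) (i + int m + 1) * Z (i + 2) (i + int m)"
    "crystal_step n m (i + 1) x Z (i + 1) (i + int m + 1) = x * Z (i + 1) (i + int m + 1)"
    "crystal_step n m (i + 1) x Z (i + 2) (i + int m + 1) = Z (i + 2) (i + int m + 1)"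
    "crystal_step n m (i + 1) x Z (i + 2) (i + int m + 2) = Z (i + 2) (i + int m + 2) / x"
    "crystal_step n m (i + 1) x Z (i + 2) (i + int m) = Z (i + 2) (i + int m)"
    if "x \<noteq> 0" "Z (i + 2) (i + int m + 1) \<noteq> 0" for x Z
    unfolding at using that n small by (simp_all add: row_add_def col_add_def field_simps)
  have cc: "c * c' \<noteq> 0" using c by simp
  define Y1 Y2 where Y12: "Y1 = crystal_step n m i c' Y" "Y2 = crystal_step n m (i + 1) (c * c') Y1"
  define Z1 Z2 where Z12: "Z1 = crystal_step n m (i + 1) c Y" "Z2 = crystal_step n m i (c * c') Z1"
  note L = L[folded Y12] and R = R[folded Z12]
  define q1 p1 P Q where coeffs: "q1 = q + (inverse c' - 1) * B / p * w"
    "p1 = p + (c * c' - 1) * (B / c') / q1 * w"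
    "P = p + (c - 1) * B / q * w" "Q = q + (inverse (c * c') - 1) * (c * B) / P * w"
  note Y1 = at_i[where x = c' and Z = Y, OF c(2) L(1), folded Y12 entries, folded coeffs]
  note Y2 = at_i1[where x = "c * c'" and Z = Y1, OF cc L(2), folded Y12, unfolded Y1, folded coeffs]
  note Z1 = at_i1[where x = c and Z = Y, OF c(1) R(1), folded Z12 entries, folded coeffs]
  note Z2 = at_i[where x = "c * c'" and Z = Z1, OF cc R(2), folded Z12, unfolded Z1, folded coeffs]
  have nz: "p \<noteq> 0" "q1 \<noteq> 0" "p1 \<noteq> 0" "q \<noteq> 0" "P \<noteq> 0" "Q \<noteq> 0"
    using L R by (simp_all add: Y1 Y2 Z1 Z2 entries)
  \<comment> \<open>All four moved pivots are, up to monomials, quotients of these two polynomials.\<close>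
  define N M where NM: "N = p * q + (c - 1) * B * w" "M = c' * p * q + (1 - c') * B * w"
  have q1: "q1 = M / (c' * p)" unfolding coeffs NM using nz c by (simp add: field_simps)
  have P: "P = N / q" unfolding coeffs NM using nz c by (simp add: field_simps)
  have MN: "M \<noteq> 0" "N \<noteq> 0" using nz q1 P by auto
  have p1: "p1 = c' * p * N / M"
    unfolding coeffs(2) q1 using nz c MN by (simp add: divide_simps) (simp add: NM algebra_simps)
  have Q: "Q = q * M / (c' * N)"
    unfolding coeffs(4) P using nz c MN by (simp add: divide_simps) (simp add: NM algebra_simps)
  define \<alpha>\<^sub>1 \<alpha>\<^sub>2 \<alpha>\<^sub>3 where \<alpha>: "\<alpha>\<^sub>1 = (c' - 1) * (A / p)" "\<alpha>\<^sub>2 = (c * c' - 1) * (B / c' / q1)" "\<alpha>\<^sub>3 = (c - 1) * (c' * A / p1)"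
  define \<beta>\<^sub>1 \<beta>\<^sub>2 \<beta>\<^sub>3 where \<beta>: "\<beta>\<^sub>1 = (c - 1) * (B / q)" "\<beta>\<^sub>2 = (c * c' - 1) * (A / P)" "\<beta>\<^sub>3 = (c' - 1) * (c * B / (c * c') / Q)"
  define \<kappa>\<^sub>1 \<kappa>\<^sub>2 \<kappa>\<^sub>3 where \<kappa>: "\<kappa>\<^sub>1 = (inverse c' - 1) * (B / p)" "\<kappa>\<^sub>2 = (inverse (c * c') - 1) * (D / q1)" "\<kappa>\<^sub>3 = (inverse c - 1) * (c * c' * (B / c') / p1)"
  define \<mu>\<^sub>1 \<mu>\<^sub>2 \<mu>\<^sub>3 where \<mu>: "\<mu>\<^sub>1 = (inverse c - 1) * (D / q)" "\<mu>\<^sub>2 = (inverse (c * c') - 1) * (c * B / P)" "\<mu>\<^sub>3 = (inverse c' - 1) * (D / c / Q)"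
  have rows: "\<alpha>\<^sub>1 + \<alpha>\<^sub>3 = \<beta>\<^sub>2" "\<alpha>\<^sub>2 = \<beta>\<^sub>1 + \<beta>\<^sub>3" "\<alpha>\<^sub>3 * \<alpha>\<^sub>2 = \<beta>\<^sub>2 * \<beta>\<^sub>1"
    unfolding \<alpha> \<beta> q1 P p1 Q using nz c MN by (simp_all add: divide_simps) (simp_all add: NM algebra_simps)
  have cols: "\<kappa>\<^sub>1 + \<kappa>\<^sub>3 = \<mu>\<^sub>2" "\<kappa>\<^sub>2 = \<mu>\<^sub>1 + \<mu>\<^sub>3" "\<kappa>\<^sub>2 * \<kappa>\<^sub>1 = \<mu>\<^sub>3 * \<mu>\<^sub>2"
    unfolding \<kappa> \<mu> q1 P p1 Q using nz c MN by (simp_all add: divide_simps) (simp_all add: NM algebra_simps)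
  have steps: "Y1 = col_add n (i + int m) \<kappa>\<^sub>1 (row_add n i \<alpha>\<^sub>1 Y)"
    "Z1 = col_add n (i + int m + 1) \<mu>\<^sub>1 (row_add n (i + 1) \<beta>\<^sub>1 Y)"
    unfolding Y12(1) Z12(1) at \<alpha> \<beta> \<kappa> \<mu> entries by (rule refl)+
  have steps2: "Y2 = col_add n (i + int m + 1) \<kappa>\<^sub>2 (row_add n (i + 1) \<alpha>\<^sub>2 Y1)"
    "Z2 = col_add n (i + int m) \<mu>\<^sub>2 (row_add n i \<beta>\<^sub>2 Z1)"
    unfolding Y12(2) Z12(2) at(2)[of _ Y1] at(1)[of _ Z1] Y1 Z1 \<alpha> \<beta> \<kappa> \<mu> by (rule refl)+
  have steps3: "crystal_step n m i c Y2 = col_add n (i + int m) \<kappa>\<^sub>3 (row_add n i \<alpha>\<^sub>3 Y2)"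
    "crystal_step n m (i + 1) c' Z2 = col_add n (i + int m + 1) \<mu>\<^sub>3 (row_add n (i + 1) \<beta>\<^sub>3 Z2)"
    unfolding at(1)[of _ Y2] at(2)[of _ Z2] Y2 Z2 \<alpha> \<beta> \<kappa> \<mu> by (rule refl)+
  show ?thesis
    unfolding Y12[symmetric] Z12[symmetric]
    unfolding steps3
    unfolding steps2
    unfolding steps
    by (simp only: row_col_commute row_add_braid[OF n rows] col_add_braid[OF n cols])
qed


section \<open>Linear sections of the unipotent loop group\<close>

text \<open>The loop group and its banded part are treated uniformly: \<open>D\<close> is the set of superdiagonals
  on which entries may be nonzero.\<close>

definition band :: "nat \<Rightarrow> int set \<Rightarrow> inf_matrix set" where
  "band n D = {Y \<in> unipotent_loop_group n. \<forall>r s. s - r \<notin> D \<longrightarrow> Y r s = 0}"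

lemma band_UNIV: "band n UNIV = unipotent_loop_group n"
  by (simp add: band_def)

lemma band_atMost: "band n {..int m} = banded_unipotent n m"
  by (auto simp: band_def banded_unipotent_def not_le)

abbreviation band_variety :: "nat \<Rightarrow> int set \<Rightarrow> inf_matrix variety" where
  "band_variety n D \<equiv> subvariety (U_variety n) (band n D)"

lemma points_band_variety [simp]: "points (band_variety n D) = band n D"
  and coord_ring_band_variety:
    "coord_ring (band_variety n D) = generated_algebra {\<lambda>Y. Y r s |r s. True}"
  by (simp_all add: subvariety_def U_variety_def)

lemma band_variety_UNIV: "band_variety n UNIV = U_variety n"
  by (simp add: band_UNIV subvariety_def U_variety_def)

lemma entry_in_ring: "(\<lambda>Y. Y r s) \<in> coord_ring (band_variety n D)"
  unfolding coord_ring_band_variety by (blast intro: generated_algebra.gen)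

lemma curve_connected_band:
  assumes "n > 0"
  shows "curve_connected_variety (band_variety n D)"
proof
  show "generated_algebra (coord_ring (band_variety n D)) = coord_ring (band_variety n D)"
    by (simp add: coord_ring_band_variety)
  fix x y assume "x \<in> points (band_variety n D)" "y \<in> points (band_variety n D)"
  then have xy: "x \<in> band n D" "y \<in> band n D" by auto
  define L where "L = (\<lambda>t r s. x r s + t * (y r s - x r s) :: complex)"
  have "L t \<in> band n D" for t
    using xy unfolding band_def L_def unipotent_loop_group_iff[OF assms] by simp
  moreover have "\<exists>p q. \<forall>t. t \<notin> {} \<longrightarrow> poly q t \<noteq> 0 \<and> f (L t) * poly q t = poly p t"
    if "f \<in> coord_ring (band_variety n D)" for f
  proof (rule rational_restriction_generated[where L = L])
    show "f \<in> generated_algebra {\<lambda>Y. Y r s |r s. True}"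
      using that by (simp add: coord_ring_band_variety)
  next
    fix g :: "inf_matrix \<Rightarrow> complex" assume "g \<in> {\<lambda>Y. Y r s |r s. True}"
    then obtain r s where "g = (\<lambda>Y. Y r s)" by blast
    then show "\<exists>p q. \<forall>t. t \<notin> {} \<longrightarrow> poly q t \<noteq> 0 \<and> g (L t) * poly q t = poly p t"
      by (intro exI[of _ "[:x r s, y r s - x r s:]"] exI[of _ 1]) (simp add: L_def)
  qed
  ultimately show "joined_by_rational_curve (band_variety n D) x y"
    unfolding joined_by_rational_curve_def
    by (intro exI[of _ L] exI[of _ "{}"]) (auto simp: L_def)
qed

text \<open>A character \<open>h\<close> is evaluation at the matrix of its values on the entry functions. This matrix is
  a point because the defining equations of \<open>band n D\<close> are equalities of regular functions.\<close>

lemma affine_variety_band: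
  assumes "n > 0" "band n D \<noteq> {}"
  shows "affine_variety (band_variety n D)"
proof -
  interpret X: curve_connected_variety "band_variety n D"
    by (rule curve_connected_band) fact
  let ?R = "coord_ring (band_variety n D)"
  have "\<exists>!x. x \<in> band n D \<and> (\<forall>f\<in>?R. h f = f x)" if "character (band_variety n D) h" for h
  proof -
    note hom = \<open>character _ h\<close>[unfolded character_def]
    have cong: "h f = h g" if "f \<in> ?R" "g \<in> ?R" "\<And>x. x \<in> band n D \<Longrightarrow> f x = g x" for f g
      by (rule conjunct1[OF hom, rule_format]) (use that in auto)
    have const: "h (\<lambda>_. c) = c" for c
      by (rule conjunct1[OF conjunct2[OF hom], rule_format])
    have h_add: "h (\<lambda>x. f x + g x) = h f + h g" if "f \<in> ?R" "g \<in> ?R" for f g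
      by (rule conjunct1[OF conjunct2[OF conjunct2[OF hom]], rule_format]) (use that in auto)
    have h_mult: "h (\<lambda>x. f x * g x) = h f * h g" if "f \<in> ?R" "g \<in> ?R" for f g
      by (rule conjunct2[OF conjunct2[OF conjunct2[OF hom]], rule_format]) (use that in auto)
    define x where "x = (\<lambda>r s. h (\<lambda>Y. Y r s))"
    have "x (r + int n) (s + int n) = x r s" for r s unfolding x_def
      by (rule cong[OF entry_in_ring entry_in_ring])
        (simp add: band_def unipotent_loop_group_iff[OF assms(1)])
    moreover have "x r s = c" if "\<And>Y. Y \<in> band n D \<Longrightarrow> Y r s = c" for r s c
      using cong[OF entry_in_ring X.const_in_ring, of r s c] const that unfolding x_def by simp
    ultimately have "x \<in> band n D"
      unfolding band_def unipotent_loop_group_iff[OF assms(1)] by simp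
    moreover have "h f = f x" if "f \<in> ?R" for f
      using that[unfolded coord_ring_band_variety]
    proof induction
      case (add f g)
      then show ?case
        using h_add[of f g, unfolded coord_ring_band_variety] by simp
    next
      case (mult f g)
      then show ?case
        using h_mult[of f g, unfolded coord_ring_band_variety] by simp
    qed (auto simp: x_def const)
    moreover have "y = x" if "\<forall>f\<in>?R. h f = f y" for y
    proof (intro ext)
      fix r s show "y r s = x r s"
        using bspec[OF that entry_in_ring[of r s]] unfolding x_def by simp
    qed
    ultimately show ?thesis by blast
  qed
  then show ?thesis
    unfolding affine_variety_def
    using assms(2) X.coord_ring_closed X.irreducible by simp
qed

lemma closedin_banded:
  assumes "n > 0"
  shows "closedin (zariski (U_variety n)) (banded_unipotent n m)"
proof -
  interpret U: curve_connected_variety "U_variety n"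
    using curve_connected_band[OF assms, of UNIV] by (simp add: band_variety_UNIV)
  have pts: "points (U_variety n) = unipotent_loop_group n" by (simp add: U_variety_def)
  have "unipotent_loop_group n - banded_unipotent n m =
      \<Union>{{Y \<in> points (U_variety n). Y i j \<noteq> 0} |i j. j - i > int m}"
    unfolding pts banded_unipotent_def by blast
  moreover have "openin (zariski (U_variety n)) {Y \<in> points (U_variety n). Y i j \<noteq> 0}" for i j
    using U.openin_basic[OF entry_in_ring[where D = UNIV, unfolded band_variety_UNIV]] .
  ultimately have "openin (zariski (U_variety n)) (unipotent_loop_group n - banded_unipotent n m)"
    by (auto intro!: openin_Union)
  then show ?thesis
    unfolding closedin_def U.topspace_zariski pts by (auto simp: banded_unipotent_def)
qed

text \<open>Outside the band, the only entries that the operator could make nonzero are those at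
  \<open>(k, k + m + 1)\<close> and its periodic translates; there the contributions of the row and of the column operation cancel.\<close>

lemma crystal_step_band:
  assumes n: "n > 1" and Y: "Y \<in> band n {..int m}" and c: "c \<noteq> 0" "Y (k + 1) (k + int m) \<noteq> 0"
  shows "crystal_step n m k c Y \<in> band n {..int m}"
proof -
  have U: "Y \<in> unipotent_loop_group n" and zero: "\<And>r s. s - r > int m \<Longrightarrow> Y r s = 0"
    using Y by (auto simp: band_def)
  have "crystal_step n m k c Y r s = 0" if "s - r > int m" for r s
  proof -
    consider (corner) "s = r + int m + 1" "int n dvd r - k"
      | (no_corner) "s = r + int m + 1" "\<not> int n dvd r - k"
      | (two) "s = r + int m + 2" | (far) "s > r + int m + 2"
      using \<open>s - r > int m\<close> by linarith
    then show ?thesis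
    proof cases
      \<comment> \<open>By periodicity \<open>k\<close> may be replaced by \<open>r\<close>, so that the three entries are next to \<open>(r, s)\<close>.\<close>
      case corner
      have "crystal_step n m k c Y = crystal_step n m r c Y"
        by (rule sym, rule crystal_step_periodic) (use U n corner in auto)
      moreover have "Y (r + 1) (r + int m) \<noteq> 0"
        using c(2) periodic_entry[OF U _ , of "r + 1" "k + 1" "r + int m" "k + int m"] n corner(2) by simp
      ultimately show ?thesis
        using n c(1) zero[of "r + int m + 1" r] corner(1)
        by (simp add: crystal_step_def row_add_def col_add_def field_simps)
    next
      case no_corner
      then show ?thesis
        using zero[of s r] by (simp add: crystal_step_def row_add_def col_add_def algebra_simps)
    next
      case two
      have "\<not> int n dvd s - 1 - (k + int m)" if "int n dvd r - k"
        using dvd_offset[OF that, of "s - 1 - (k + int m)" 1] n two by simp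
      then show ?thesis
        using zero[of s r] zero[of s "r + 1"] zero[of "s - 1" r] two
        by (auto simp: crystal_step_def row_add_def col_add_def)
    next
      case far
      then show ?thesis
        using zero[of s r] zero[of s "r + 1"] zero[of "s - 1" r] zero[of "s - 1" "r + 1"]
        by (simp add: crystal_step_def row_add_def col_add_def)
    qed
  qed
  then show ?thesis
    using crystal_step_unipotent[OF _ U] n by (auto simp: band_def)
qed

lemma (in curve_connected_variety) regular_at_crystal_step:
  assumes "\<And>r s. regular_at V x (\<lambda>z. H z r s)" "regular_at V x a" "a x \<noteq> 0"
    and "H x (k + 1) (k + int m) \<noteq> 0" "x \<in> points V"
  shows "regular_at V x (\<lambda>z. crystal_step n m k (a z) (H z) r s)"
  unfolding crystal_step_def row_add_def col_add_def
  using assms by (cases "int n dvd r - k"; cases "int n dvd s - 1 - (k + int m)")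
    (simp_all, (intro regular_at_intros; assumption)+)

lemma (in curve_connected_variety) eventually_in_points:
  assumes "x \<in> points V"
  shows "eventually (\<lambda>z. z \<in> points V) (nhdsin (zariski V) x)"
  unfolding eventually_zariski[OF assms]
  by (rule bexI[of _ "\<lambda>_. 1"]) (auto intro: const_in_ring)

lemma (in curve_connected_variety) regular_at_generated:
  assumes "g \<in> generated_algebra F" "\<And>f. f \<in> F \<Longrightarrow> regular_at V x (\<lambda>z. f (H z))"
  shows "regular_at V x (\<lambda>z. g (H z))"
  using assms(1) by induction (auto intro: regular_at_intros assms(2))


section \<open>The geometric crystal on a linear section\<close>

text \<open>All nonemptiness questions about domains of composed operators are settled at this point with
  all parameters \<open>c\<close> equal to 1, when every operator fixes it.\<close>

definition base_point :: "nat \<Rightarrow> inf_matrix" where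
  "base_point m = (\<lambda>r s. if 0 \<le> s - r \<and> s - r \<le> int m then 1 else 0)"

text \<open>Since \<open>D\<close> contains \<open>{0..m}\<close>, pivots and their neighbours are not forced to vanish.\<close>

locale invariant_band =
  fixes n m :: nat and D :: "int set"
  assumes n: "n > 1" and m: "m \<ge> 1" and D: "{0..int m} \<subseteq> D"
    and step_band: "\<And>k c Y. Y \<in> band n D \<Longrightarrow> c \<noteq> 0 \<Longrightarrow> Y (k + 1) (k + int m) \<noteq> 0 \<Longrightarrow>
      crystal_step n m k c Y \<in> band n D"
begin

abbreviation "X \<equiv> band_variety n D"
abbreviation "eps k \<equiv> U_eps n m k |` band n D"
abbreviation "phi k \<equiv> U_phi n m k |` band n D"
abbreviation "gam k \<equiv> rational_div (phi k) (eps k)"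
abbreviation "E k c \<equiv> U_e n m k c |` band n D"

(* These rules would replace restricted operators by unrestricted ones, which have larger domains. *)
declare restrict_in [simp del] dom_restrict [simp del]

lemma band_subset: "Y \<in> band n D \<Longrightarrow> Y \<in> unipotent_loop_group n"
  by (simp add: band_def)

lemma eps_apply: "eps k Y = (if Y \<in> band n D \<and> Y (k + 1) (k + int m) \<noteq> 0
    then Some (Y (k + 1) (k + int m + 1) / Y (k + 1) (k + int m)) else None)"
  by (simp add: U_eps_def restrict_map_def band_subset)

lemma phi_apply: "phi k Y = (if Y \<in> band n D \<and> Y (k + 1) (k + int m) \<noteq> 0
    then Some (Y k (k + int m) / Y (k + 1) (k + int m)) else None)"
  by (simp add: U_phi_def restrict_map_def band_subset)

lemma gam_apply: "gam k Y = (if Y \<in> band n D \<and> Y (k + 1) (k + int m) \<noteq> 0 \<and> Y (k + 1) (k + int m + 1) \<noteq> 0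
    then Some (Y k (k + int m) / Y (k + 1) (k + int m + 1)) else None)"
  by (simp add: rational_div_def eps_apply phi_apply)

lemma E_apply: "E k c Y = (if Y \<in> band n D \<and> Y (k + 1) (k + int m) \<noteq> 0 \<and> c \<noteq> 0
    then Some (crystal_step n m k c Y) else None)"
  by (simp add: U_e_eq_crystal_step restrict_map_def band_subset)

lemma E_Some_iff: "E k c Y = Some A \<longleftrightarrow>
    Y \<in> band n D \<and> Y (k + 1) (k + int m) \<noteq> 0 \<and> c \<noteq> 0 \<and> A = crystal_step n m k c Y"
  by (auto simp: E_apply)

lemma base_point_band: "base_point m \<in> band n D"
proof -
  have "base_point m (r + int n) (s + int n) = base_point m r s" for r s
    by (simp add: base_point_def)
  then show ?thesis
    using n D by (auto simp: band_def unipotent_loop_group_iff base_point_def)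
qed

lemma base_point_pivot: "base_point m (k + 1) (k + int m) = 1" "base_point m (k + 1) (k + int m + 1) = 1"
  using m by (simp_all add: base_point_def)

sublocale X: curve_connected_variety X
  using n by (intro curve_connected_band) simp

sublocale GX: curve_connected_variety "Gm \<times>\<^sub>v X"
  by (intro curve_connected_prod curve_connected_Gm X.curve_connected_variety_axioms)

sublocale GGX: curve_connected_variety "Gm \<times>\<^sub>v Gm \<times>\<^sub>v X"
  by (intro curve_connected_prod curve_connected_Gm X.curve_connected_variety_axioms)

subsection \<open>Domains of composed operators\<close>

text \<open>Families of points of the crystal that pass regularly through the base point.\<close>

definition based_family :: "'b variety \<Rightarrow> 'b \<Rightarrow> ('b \<Rightarrow> inf_matrix) \<Rightarrow> bool" where
  "based_family V x H \<longleftrightarrow> (\<forall>r s. regular_at V x (\<lambda>z. H z r s)) \<and> H x = base_point m \<and>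
     eventually (\<lambda>z. H z \<in> band n D) (nhdsin (zariski V) x)"

lemma based_family_nonzero:
  assumes "curve_connected_variety V" "x \<in> points V" "based_family V x H"
  shows "eventually (\<lambda>z. H z (k + 1) (k + int m) \<noteq> 0) (nhdsin (zariski V) x)"
    and "eventually (\<lambda>z. H z (k + 1) (k + int m + 1) \<noteq> 0) (nhdsin (zariski V) x)"
proof -
  interpret V: curve_connected_variety V by fact
  show "eventually (\<lambda>z. H z (k + 1) (k + int m) \<noteq> 0) (nhdsin (zariski V) x)"
    "eventually (\<lambda>z. H z (k + 1) (k + int m + 1) \<noteq> 0) (nhdsin (zariski V) x)"
    using assms(3) unfolding based_family_def
    by (auto intro!: V.regular_at_eventually_nonzero assms(2) simp: base_point_pivot)
qed

text \<open>Applying an operator whose parameter passes through 1 yields another family of the same kind, so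
  this lemma can be iterated along compositions.\<close>

lemma based_family_E:
  assumes "curve_connected_variety V" "x \<in> points V" "based_family V x H"
    and a: "regular_at V x a" "a x = 1"
  shows "eventually (\<lambda>z. E k (a z) (H z) = Some (crystal_step n m k (a z) (H z))) (nhdsin (zariski V) x)"
    and "based_family V x (\<lambda>z. crystal_step n m k (a z) (H z))"
proof -
  interpret V: curve_connected_variety V by fact
  have H: "regular_at V x (\<lambda>z. H z r s)" "H x = base_point m"
    and H_band: "eventually (\<lambda>z. H z \<in> band n D) (nhdsin (zariski V) x)" for r s
    using assms(3) by (simp_all add: based_family_def)
  have "eventually (\<lambda>z. a z \<noteq> 0) (nhdsin (zariski V) x)"
    by (rule V.regular_at_eventually_nonzero) (use assms in auto)
  then have ev: "eventually (\<lambda>z. H z \<in> band n D \<and> H z (k + 1) (k + int m) \<noteq> 0 \<and> a z \<noteq> 0) (nhdsin (zariski V) x)"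
    using H_band based_family_nonzero(1)[OF assms(1-3), of k] by eventually_elim simp
  then show "eventually (\<lambda>z. E k (a z) (H z) = Some (crystal_step n m k (a z) (H z))) (nhdsin (zariski V) x)"
    by eventually_elim (simp add: E_apply)
  have "eventually (\<lambda>z. crystal_step n m k (a z) (H z) \<in> band n D) (nhdsin (zariski V) x)"
    using ev by eventually_elim (simp add: step_band)
  moreover have "regular_at V x (\<lambda>z. crystal_step n m k (a z) (H z) r s)" for r s
    by (rule V.regular_at_crystal_step[OF H(1) a(1) _ _ assms(2)])
      (simp_all add: H(2) a(2) base_point_pivot)
  ultimately show "based_family V x (\<lambda>z. crystal_step n m k (a z) (H z))"
    using H(2) a(2) by (simp add: based_family_def)
qed

lemma dense_domI:
  assumes "curve_connected_variety V" "x \<in> points V"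
    and "eventually (\<lambda>z. f z \<noteq> None) (nhdsin (zariski V) x)"
  shows "zariski_dense V (points V \<inter> dom f)"
proof -
  interpret V: curve_connected_variety V by fact
  from assms(3) V.eventually_in_points[OF assms(2)]
  have "eventually (\<lambda>z. z \<in> points V \<inter> dom f) (nhdsin (zariski V) x)"
    by eventually_elim auto
  then show ?thesis by (rule V.zariski_dense_if_eventually[OF assms(2)])
qed

abbreviation "base\<^sub>1 \<equiv> (1 :: complex, base_point m)"
abbreviation "base\<^sub>2 \<equiv> (1 :: complex, 1 :: complex, base_point m)"

lemma base_in_points: "base_point m \<in> points X" "base\<^sub>1 \<in> points (Gm \<times>\<^sub>v X)"
  "base\<^sub>2 \<in> points (Gm \<times>\<^sub>v Gm \<times>\<^sub>v X)"
  using base_point_band by auto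

lemma based_familyI:
  assumes "curve_connected_variety V" "x \<in> points V" "H x = base_point m"
    and "\<And>z. z \<in> points V \<Longrightarrow> H z \<in> band n D" "\<And>r s. (\<lambda>z. H z r s) \<in> coord_ring V"
  shows "based_family V x H"
proof -
  interpret V: curve_connected_variety V by fact
  have "eventually (\<lambda>z. H z \<in> band n D) (nhdsin (zariski V) x)"
    using V.eventually_in_points[OF assms(2)] assms(4) by (rule eventually_mono)
  then show ?thesis
    unfolding based_family_def using assms(3) V.regular_at_ring[OF assms(5)] by blast
qed

lemma based_family_id: "based_family X (base_point m) (\<lambda>Y. Y)"
  by (rule based_familyI[OF X.curve_connected_variety_axioms base_in_points(1)])
    (simp_all add: entry_in_ring)

lemma based_family_snd: "based_family (Gm \<times>\<^sub>v X) base\<^sub>1 snd"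
  by (rule based_familyI[OF GX.curve_connected_variety_axioms base_in_points(2)])
    (auto intro: prod_ring_snd[OF entry_in_ring])

lemma based_family_snd_snd: "based_family (Gm \<times>\<^sub>v Gm \<times>\<^sub>v X) base\<^sub>2 (\<lambda>z. snd (snd z))"
  by (rule based_familyI[OF GGX.curve_connected_variety_axioms base_in_points(3)])
    (auto intro: prod_ring_snd[OF prod_ring_snd[OF entry_in_ring]])

lemma regular_fst: "regular_at (Gm \<times>\<^sub>v X) z fst"
  using GX.regular_at_ring[OF prod_ring_fst[OF Gm_ring]] by simp

lemma regular_parameters:
  "regular_at (Gm \<times>\<^sub>v Gm \<times>\<^sub>v X) z fst"
  "regular_at (Gm \<times>\<^sub>v Gm \<times>\<^sub>v X) z (\<lambda>z. fst (snd z))"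
  "regular_at (Gm \<times>\<^sub>v Gm \<times>\<^sub>v X) z (\<lambda>z. fst z * fst (snd z))"
proof -
  show *: "regular_at (Gm \<times>\<^sub>v Gm \<times>\<^sub>v X) z fst"
    using GGX.regular_at_ring[OF prod_ring_fst[OF Gm_ring]] by simp
  show "regular_at (Gm \<times>\<^sub>v Gm \<times>\<^sub>v X) z (\<lambda>z. fst (snd z))"
    using GGX.regular_at_ring[OF prod_ring_snd[OF prod_ring_fst[OF Gm_ring]]] .
  from GGX.regular_at_mult[OF * this] show "regular_at (Gm \<times>\<^sub>v Gm \<times>\<^sub>v X) z (\<lambda>z. fst z * fst (snd z))" .
qed

lemmas family\<^sub>1 = based_family_E[OF GX.curve_connected_variety_axioms base_in_points(2)]
lemmas family\<^sub>2 = based_family_E[OF GGX.curve_connected_variety_axioms base_in_points(3)]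
lemmas dense\<^sub>1 = dense_domI[OF GX.curve_connected_variety_axioms base_in_points(2)]
lemmas dense\<^sub>2 = dense_domI[OF GGX.curve_connected_variety_axioms base_in_points(3)]

lemma dense_pair:
  assumes "regular_at (Gm \<times>\<^sub>v Gm \<times>\<^sub>v X) base\<^sub>2 a" "a base\<^sub>2 = 1"
    and "regular_at (Gm \<times>\<^sub>v Gm \<times>\<^sub>v X) base\<^sub>2 b" "b base\<^sub>2 = 1"
  shows "zariski_dense (Gm \<times>\<^sub>v Gm \<times>\<^sub>v X) (points (Gm \<times>\<^sub>v Gm \<times>\<^sub>v X) \<inter>
    dom (\<lambda>z. (E i (a z) \<circ>\<^sub>m E j (b z)) (snd (snd z))))"
proof (rule dense\<^sub>2)
  note 1 = family\<^sub>2[OF based_family_snd_snd assms(3,4), of j]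
  note 2 = family\<^sub>2[OF 1(2) assms(1,2), of i]
  from 1(1) 2(1) show "eventually (\<lambda>z. (E i (a z) \<circ>\<^sub>m E j (b z)) (snd (snd z)) \<noteq> None)
      (nhdsin (zariski (Gm \<times>\<^sub>v Gm \<times>\<^sub>v X)) base\<^sub>2)"
    by eventually_elim (simp add: map_comp_def)
qed

lemma dense_triple:
  assumes "regular_at (Gm \<times>\<^sub>v Gm \<times>\<^sub>v X) base\<^sub>2 a" "a base\<^sub>2 = 1"
    and "regular_at (Gm \<times>\<^sub>v Gm \<times>\<^sub>v X) base\<^sub>2 b" "b base\<^sub>2 = 1"
    and "regular_at (Gm \<times>\<^sub>v Gm \<times>\<^sub>v X) base\<^sub>2 c" "c base\<^sub>2 = 1"
  shows "zariski_dense (Gm \<times>\<^sub>v Gm \<times>\<^sub>v X) (points (Gm \<times>\<^sub>v Gm \<times>\<^sub>v X) \<inter>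
    dom (\<lambda>z. (E i (a z) \<circ>\<^sub>m E j (b z) \<circ>\<^sub>m E k (c z)) (snd (snd z))))"
proof (rule dense\<^sub>2)
  note 1 = family\<^sub>2[OF based_family_snd_snd assms(5,6), of k]
  note 2 = family\<^sub>2[OF 1(2) assms(3,4), of j]
  note 3 = family\<^sub>2[OF 2(2) assms(1,2), of i]
  from 1(1) 2(1) 3(1) show "eventually (\<lambda>z. (E i (a z) \<circ>\<^sub>m E j (b z) \<circ>\<^sub>m E k (c z)) (snd (snd z)) \<noteq> None)
      (nhdsin (zariski (Gm \<times>\<^sub>v Gm \<times>\<^sub>v X)) base\<^sub>2)"
    by eventually_elim (simp add: map_comp_def)
qed

end


context invariant_band
begin

subsection \<open>Rational functions and actions\<close>

lemma rational_eps: "rational_function X (eps k)"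
proof (rule X.rational_functionI)
  show "openin (zariski X) {Y \<in> points X. Y (k + 1) (k + int m) \<noteq> 0}"
    by (rule X.openin_basic[OF entry_in_ring])
  show "{Y \<in> points X. Y (k + 1) (k + int m) \<noteq> 0} \<noteq> {}"
    using base_point_band base_point_pivot(1)[of k] by fastforce
qed (auto simp: eps_apply intro!: X.regular_at_divide X.regular_at_ring[OF entry_in_ring])

lemma rational_phi: "rational_function X (phi k)"
proof (rule X.rational_functionI)
  show "openin (zariski X) {Y \<in> points X. Y (k + 1) (k + int m) \<noteq> 0}"
    by (rule X.openin_basic[OF entry_in_ring])
  show "{Y \<in> points X. Y (k + 1) (k + int m) \<noteq> 0} \<noteq> {}"
    using base_point_band base_point_pivot(1)[of k] by fastforce
qed (auto simp: phi_apply intro!: X.regular_at_divide X.regular_at_ring[OF entry_in_ring])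

lemma rational_gam: "rational_function X (gam k)"
proof (rule X.rational_functionI)
  let ?S = "{Y \<in> points X. Y (k + 1) (k + int m) * Y (k + 1) (k + int m + 1) \<noteq> 0}"
  show "openin (zariski X) ?S"
    by (rule X.openin_basic[OF X.mult_in_ring[OF entry_in_ring entry_in_ring]])
  show "?S \<noteq> {}"
    using base_point_band base_point_pivot[of k] by fastforce
qed (auto simp: gam_apply intro!: X.regular_at_divide X.regular_at_ring[OF entry_in_ring])

lemma rational_map_E: "rational_map (Gm \<times>\<^sub>v X) X (\<lambda>(c, Y). E k c Y)"
proof -
  define S where "S = {z \<in> points (Gm \<times>\<^sub>v X). snd z (k + 1) (k + int m) \<noteq> 0}"
  have dom: "dom (\<lambda>(c, Y). E k c Y) = S"
    by (auto simp: S_def E_apply split: if_splits)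
  have opn: "openin (zariski (Gm \<times>\<^sub>v X)) S"
    unfolding S_def by (rule GX.openin_basic[OF prod_ring_snd[OF entry_in_ring]])
  have base: "base\<^sub>1 \<in> S"
    using base_in_points(2) base_point_pivot(1)[of k] by (simp add: S_def)
  have "rational_function (Gm \<times>\<^sub>v X) (\<lambda>z. map_option g (case z of (c, Y) \<Rightarrow> E k c Y))"
    if "g \<in> coord_ring X" for g
  proof (rule GX.rational_functionI[OF opn, where h = "\<lambda>z. g (crystal_step n m k (fst z) (snd z))"])
    show "S \<noteq> {}" using base by blast
    fix z assume z: "z \<in> S"
    have "regular_at (Gm \<times>\<^sub>v X) z (\<lambda>z. crystal_step n m k (fst z) (snd z) r s)" for r s
      by (rule GX.regular_at_crystal_step)
        (use z in \<open>auto simp: S_def intro!: regular_fst GX.regular_at_ring prod_ring_snd[OF entry_in_ring]\<close>)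
    then show "regular_at (Gm \<times>\<^sub>v X) z (\<lambda>z. g (crystal_step n m k (fst z) (snd z)))"
      by (intro GX.regular_at_generated[OF that[unfolded coord_ring_band_variety]]) auto
  qed (auto simp: S_def E_apply split: prod.splits)
  moreover have "ran (\<lambda>(c, Y). E k c Y) \<subseteq> points X"
    by (auto simp: ran_def E_apply step_band split: if_splits)
  ultimately show ?thesis
    unfolding rational_map_def dom using opn GX.zariski_dense_openin[OF opn base] by blast
qed

lemma rational_action_E: "rational_action X (E k)"
  unfolding rational_action_def
proof (intro conjI rational_map_E)
  show "rational_eq X (E k 1) Some"
    unfolding rational_eq_def
  proof (intro conjI)
    have "eventually (\<lambda>Y. E k 1 Y \<noteq> None) (nhdsin (zariski X) (base_point m))"
      using based_family_E(1)[OF X.curve_connected_variety_axioms base_in_points(1) based_family_id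
          X.regular_at_const[of _ 1] refl, of k]
      by eventually_elim auto
    then show "zariski_dense X (points X \<inter> dom (E k 1))"
      by (rule dense_domI[OF X.curve_connected_variety_axioms base_in_points(1)])
    show "zariski_dense X (points X \<inter> dom Some)"
      by (rule dense_domI[OF X.curve_connected_variety_axioms base_in_points(1)]) simp
  qed (auto simp: E_apply split: if_splits)
  show "rational_eq (Gm \<times>\<^sub>v Gm \<times>\<^sub>v X)
      (\<lambda>(c, c', x). (E k c \<circ>\<^sub>m E k c') x) (\<lambda>(c, c', x). E k (c * c') x)"
    unfolding rational_eq_def case_prod_unfold
  proof (intro conjI ballI)
    show "zariski_dense (Gm \<times>\<^sub>v Gm \<times>\<^sub>v X) (points (Gm \<times>\<^sub>v Gm \<times>\<^sub>v X) \<inter>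
        dom (\<lambda>z. (E k (fst z) \<circ>\<^sub>m E k (fst (snd z))) (snd (snd z))))"
      by (rule dense_pair) (simp_all add: regular_parameters)
    have "eventually (\<lambda>z. E k (fst z * fst (snd z)) (snd (snd z)) \<noteq> None)
        (nhdsin (zariski (Gm \<times>\<^sub>v Gm \<times>\<^sub>v X)) base\<^sub>2)"
      using family\<^sub>2(1)[OF based_family_snd_snd regular_parameters(3), of k] by (auto elim: eventually_mono)
    then show "zariski_dense (Gm \<times>\<^sub>v Gm \<times>\<^sub>v X) (points (Gm \<times>\<^sub>v Gm \<times>\<^sub>v X) \<inter>
        dom (\<lambda>z. E k (fst z * fst (snd z)) (snd (snd z))))"
      by (rule dense\<^sub>2)
  next
    fix z assume "z \<in> points (Gm \<times>\<^sub>v Gm \<times>\<^sub>v X) \<inter>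
      dom (\<lambda>z. (E k (fst z) \<circ>\<^sub>m E k (fst (snd z))) (snd (snd z))) \<inter>
      dom (\<lambda>z. E k (fst z * fst (snd z)) (snd (snd z)))"
    moreover obtain c c' Y where z: "z = (c, c', Y)" by (cases z)
    ultimately obtain A B where AB: "(E k c \<circ>\<^sub>m E k c') Y = Some A" "E k (c * c') Y = Some B" by auto
    then have "A = B"
      unfolding map_comp_Some_iff E_Some_iff using crystal_step_mult[OF n, of c c' Y] by auto
    then show "(E k (fst z) \<circ>\<^sub>m E k (fst (snd z))) (snd (snd z)) = E k (fst z * fst (snd z)) (snd (snd z))"
      using AB z by simp
  qed
qed

lemma E_cong:
  assumes "int n dvd k' - k"
  shows "E k' c = E k c"
proof
  fix Y
  have "Y (k' + 1) (k' + int m) = Y (k + 1) (k + int m)" if "Y \<in> band n D"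
    by (rule periodic_entry[OF band_subset[OF that]]) (use assms n in auto)
  then show "E k' c Y = E k c Y"
    using crystal_step_periodic[OF _ band_subset assms, of Y m c] n
    by (cases "Y \<in> band n D") (simp_all add: E_apply)
qed

lemma periodic_index: "eps (k + int n) = eps k" "phi (k + int n) = phi k" "gam (k + int n) = gam k"
  "E (k + int n) = E k"
proof -
  have entry: "Y (k + int n + a) (k + int n + b) = Y (k + a) (k + b)" if "Y \<in> band n D" for Y a b
    by (rule periodic_entry[OF band_subset[OF that]]) (use n in auto)
  show eps: "eps (k + int n) = eps k"
  proof
    fix Y show "eps (k + int n) Y = eps k Y"
      using entry[of Y 1 "int m"] entry[of Y 1 "int m + 1"]
      by (cases "Y \<in> band n D") (simp_all add: eps_apply add.assoc)
  qed
  show phi: "phi (k + int n) = phi k"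
  proof
    fix Y show "phi (k + int n) Y = phi k Y"
      using entry[of Y 1 "int m"] entry[of Y 0 "int m"]
      by (cases "Y \<in> band n D") (simp_all add: phi_apply)
  qed
  show "gam (k + int n) = gam k" by (simp only: eps phi)
  show "E (k + int n) = E k" by (rule ext, rule E_cong) simp
qed

subsection \<open>The crystal axioms\<close>

lemma dense_E: "zariski_dense X (dom (E k 1))"
proof -
  have "dom (E k 1) = points X \<inter> dom (E k 1)" by (auto simp: E_apply split: if_splits)
  then show ?thesis
    using rational_action_E[of k] unfolding rational_action_def rational_eq_def by simp
qed

lemma gam_E_eq:
  "rational_eq (Gm \<times>\<^sub>v X) (\<lambda>(c, x). (gam j \<circ>\<^sub>m E i c) x)
     (\<lambda>(c, x). map_option (\<lambda>a. c powi cartan n i j * a) (gam j x))"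
  unfolding rational_eq_def case_prod_unfold
proof (intro conjI ballI)
  note E = family\<^sub>1[OF based_family_snd regular_fst, of i, simplified]
  note fam = based_family_nonzero[OF GX.curve_connected_variety_axioms base_in_points(2)]
  have gam_defined: "eventually (\<lambda>z. gam j (H z) \<noteq> None) (nhdsin (zariski (Gm \<times>\<^sub>v X)) base\<^sub>1)"
    if H: "based_family (Gm \<times>\<^sub>v X) base\<^sub>1 H" for H
  proof -
    have "eventually (\<lambda>z. H z \<in> band n D) (nhdsin (zariski (Gm \<times>\<^sub>v X)) base\<^sub>1)"
      using H by (simp add: based_family_def)
    with fam[OF H, of j] show ?thesis by eventually_elim (simp add: gam_apply)
  qed
  show "zariski_dense (Gm \<times>\<^sub>v X) (points (Gm \<times>\<^sub>v X) \<inter> dom (\<lambda>z. (gam j \<circ>\<^sub>m E i (fst z)) (snd z)))"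
  proof (rule dense\<^sub>1)
    from E(1) gam_defined[OF E(2)]
    show "eventually (\<lambda>z. (gam j \<circ>\<^sub>m E i (fst z)) (snd z) \<noteq> None) (nhdsin (zariski (Gm \<times>\<^sub>v X)) base\<^sub>1)"
      by eventually_elim (simp add: map_comp_def)
  qed
  show "zariski_dense (Gm \<times>\<^sub>v X) (points (Gm \<times>\<^sub>v X) \<inter>
      dom (\<lambda>z. map_option (\<lambda>a. fst z powi cartan n i j * a) (gam j (snd z))))"
    by (rule dense\<^sub>1) (use gam_defined[OF based_family_snd] in simp)
next
  fix z assume "z \<in> points (Gm \<times>\<^sub>v X) \<inter> dom (\<lambda>z. (gam j \<circ>\<^sub>m E i (fst z)) (snd z)) \<inter>
    dom (\<lambda>z. map_option (\<lambda>a. fst z powi cartan n i j * a) (gam j (snd z)))"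
  moreover obtain c Y where z: "z = (c, Y)" by (cases z)
  ultimately obtain a b where ab: "(gam j \<circ>\<^sub>m E i c) Y = Some a" "gam j Y = Some b" by auto
  define Y' where "Y' = crystal_step n m i c Y"
  have Y: "Y \<in> band n D" "Y (i + 1) (i + int m) \<noteq> 0" "c \<noteq> 0"
    and a: "a = Y' j (j + int m) / Y' (j + 1) (j + 1 + int m)"
    and b: "b = Y j (j + int m) / Y (j + 1) (j + 1 + int m)"
    using ab unfolding map_comp_def by (auto simp: E_apply gam_apply Y'_def ac_simps split: if_splits)
  have "a = c powi cartan n i j * b"
    unfolding a b Y'_def crystal_step_superdiagonal[OF n band_subset[OF Y(1)] Y(3,2)] cartan_eq[OF n]
    using Y(3) by (simp add: power_int_diff power_int_add power2_eq_square field_simps)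
  then show "(gam j \<circ>\<^sub>m E i (fst z)) (snd z) = map_option (\<lambda>a. fst z powi cartan n i j * a) (gam j (snd z))"
    using ab z by simp
qed

lemma eps_E_eq:
  "rational_eq (Gm \<times>\<^sub>v X) (\<lambda>(c, x). (eps i \<circ>\<^sub>m E i c) x)
     (\<lambda>(c, x). map_option (\<lambda>a. inverse c * a) (eps i x))"
  unfolding rational_eq_def case_prod_unfold
proof (intro conjI ballI)
  note E = family\<^sub>1[OF based_family_snd regular_fst, of i, simplified]
  note fam = based_family_nonzero[OF GX.curve_connected_variety_axioms base_in_points(2)]
  have eps_defined: "eventually (\<lambda>z. eps i (H z) \<noteq> None) (nhdsin (zariski (Gm \<times>\<^sub>v X)) base\<^sub>1)"
    if H: "based_family (Gm \<times>\<^sub>v X) base\<^sub>1 H" for H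
  proof -
    have "eventually (\<lambda>z. H z \<in> band n D) (nhdsin (zariski (Gm \<times>\<^sub>v X)) base\<^sub>1)"
      using H by (simp add: based_family_def)
    with fam(1)[OF H, of i] show ?thesis by eventually_elim (simp add: eps_apply)
  qed
  show "zariski_dense (Gm \<times>\<^sub>v X) (points (Gm \<times>\<^sub>v X) \<inter> dom (\<lambda>z. (eps i \<circ>\<^sub>m E i (fst z)) (snd z)))"
  proof (rule dense\<^sub>1)
    from E(1) eps_defined[OF E(2)]
    show "eventually (\<lambda>z. (eps i \<circ>\<^sub>m E i (fst z)) (snd z) \<noteq> None) (nhdsin (zariski (Gm \<times>\<^sub>v X)) base\<^sub>1)"
      by eventually_elim (simp add: map_comp_def)
  qed
  show "zariski_dense (Gm \<times>\<^sub>v X) (points (Gm \<times>\<^sub>v X) \<inter>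
      dom (\<lambda>z. map_option (\<lambda>a. inverse (fst z) * a) (eps i (snd z))))"
    by (rule dense\<^sub>1) (use eps_defined[OF based_family_snd] in simp)
qed (auto simp: map_comp_def E_apply eps_apply crystal_step_pivot[OF n]
    crystal_step_below_pivot[OF n] step_band split: if_splits)

lemma E_commute_eq:
  assumes "\<not> [i = j] (mod int n)" "cartan n i j = 0"
  shows "rational_eq (Gm \<times>\<^sub>v Gm \<times>\<^sub>v X) (\<lambda>(c, c', x). (E i c \<circ>\<^sub>m E j c') x)
    (\<lambda>(c, c', x). (E j c' \<circ>\<^sub>m E i c) x)"
  unfolding rational_eq_def case_prod_unfold
proof (intro conjI ballI)
  fix z assume "z \<in> points (Gm \<times>\<^sub>v Gm \<times>\<^sub>v X) \<inter>
    dom (\<lambda>z. (E i (fst z) \<circ>\<^sub>m E j (fst (snd z))) (snd (snd z))) \<inter>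
    dom (\<lambda>z. (E j (fst (snd z)) \<circ>\<^sub>m E i (fst z)) (snd (snd z)))"
  moreover obtain c c' Y where z: "z = (c, c', Y)" by (cases z)
  moreover have "\<not> int n dvd j - i" "\<not> int n dvd j - i - 1" "\<not> int n dvd j - i + 1"
    using assms unfolding cartan_eq[OF n]
    by (auto simp: cong_iff_dvd_diff dvd_diff_commute[of _ i j] of_bool_def algebra_simps split: if_splits)
  then have commute: "crystal_step n m j c' (crystal_step n m i c Y) = crystal_step n m i c (crystal_step n m j c' Y)"
    for c c' Y by (rule crystal_step_commute[OF n])
  ultimately obtain A B where AB: "(E i c \<circ>\<^sub>m E j c') Y = Some A" "(E j c' \<circ>\<^sub>m E i c) Y = Some B"
    by auto
  then have "A = B"
    unfolding map_comp_Some_iff E_Some_iff using commute[of c' c Y] by auto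
  then show "(E i (fst z) \<circ>\<^sub>m E j (fst (snd z))) (snd (snd z)) =
      (E j (fst (snd z)) \<circ>\<^sub>m E i (fst z)) (snd (snd z))"
    using AB z by simp
qed (rule dense_pair; simp add: regular_parameters)+

lemma E_braid:
  assumes "n > 2" "(E i c \<circ>\<^sub>m E (i + 1) (c * c') \<circ>\<^sub>m E i c') Y = Some A"
    "(E (i + 1) c' \<circ>\<^sub>m E i (c * c') \<circ>\<^sub>m E (i + 1) c) Y = Some B"
  shows "A = B"
  using crystal_step_braid[OF assms(1), of c c' Y i m] assms(2,3)
  unfolding map_comp_Some_iff E_Some_iff by (auto simp: algebra_simps)

lemma E_braid_eq:
  assumes "\<not> [i = j] (mod int n)" "cartan n i j = - 1"
  shows "rational_eq (Gm \<times>\<^sub>v Gm \<times>\<^sub>v X)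
    (\<lambda>(c, c', x). (E i c \<circ>\<^sub>m E j (c * c') \<circ>\<^sub>m E i c') x)
    (\<lambda>(c, c', x). (E j c' \<circ>\<^sub>m E i (c * c') \<circ>\<^sub>m E j c) x)"
  unfolding rational_eq_def case_prod_unfold
proof (intro conjI ballI)
  fix z assume "z \<in> points (Gm \<times>\<^sub>v Gm \<times>\<^sub>v X) \<inter>
    dom (\<lambda>z. (E i (fst z) \<circ>\<^sub>m E j (fst z * fst (snd z)) \<circ>\<^sub>m E i (fst (snd z))) (snd (snd z))) \<inter>
    dom (\<lambda>z. (E j (fst (snd z)) \<circ>\<^sub>m E i (fst z * fst (snd z)) \<circ>\<^sub>m E j (fst z)) (snd (snd z)))"
  moreover obtain c c' Y where z: "z = (c, c', Y)" by (cases z)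
  ultimately obtain A B where AB: "(E i c \<circ>\<^sub>m E j (c * c') \<circ>\<^sub>m E i c') Y = Some A"
    "(E j c' \<circ>\<^sub>m E i (c * c') \<circ>\<^sub>m E j c) Y = Some B" by auto
  have n2: "n > 2"
    using assms n by (cases "n = 2") (auto simp: cartan_def)
  have "int n dvd j - (i + 1) \<or> int n dvd i - (j + 1)"
    using assms unfolding cartan_eq[OF n] dvd_diff_commute[of _ i "j + 1"]
    by (auto simp: of_bool_def diff_diff_eq2 algebra_simps split: if_splits)
  then have "A = B"
  proof
    assume "int n dvd j - (i + 1)"
    from E_braid[OF n2 AB[unfolded E_cong[OF this]]] show ?thesis .
  next
    \<comment> \<open>The relation is symmetric under exchanging \<open>i\<close> with \<open>j\<close> and \<open>c\<close> with \<open>c'\<close>.\<close>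
    assume "int n dvd i - (j + 1)"
    from E_braid[OF n2, of j c' c] AB[unfolded E_cong[OF this]] show ?thesis
      by (metis mult.commute)
  qed
  then show "(E i (fst z) \<circ>\<^sub>m E j (fst z * fst (snd z)) \<circ>\<^sub>m E i (fst (snd z))) (snd (snd z)) =
      (E j (fst (snd z)) \<circ>\<^sub>m E i (fst z * fst (snd z)) \<circ>\<^sub>m E j (fst z)) (snd (snd z))"
    using AB z by simp
qed (rule dense_triple; simp add: regular_parameters)+

theorem geometric_crystal_band: "geometric_crystal_phi n X eps phi E"
  unfolding geometric_crystal_phi_def geometric_crystal_def
  using affine_variety_band[of n D] base_point_band n
  by (auto simp: periodic_index rational_eps rational_phi rational_gam rational_action_E dense_E
      gam_E_eq eps_E_eq E_commute_eq E_braid_eq)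

end

lemma U_restrict: "U_eps n m k |` band n UNIV = U_eps n m k" "U_phi n m k |` band n UNIV = U_phi n m k"
  "U_e n m k c |` band n UNIV = U_e n m k c"
  by (auto simp: band_UNIV U_eps_def U_phi_def U_e_eq_crystal_step restrict_map_def)

theorem theorem3p1:
  fixes n m :: nat
  assumes "n > 1" and "m \<ge> 1"
  shows "geometric_crystal_phi n (U_variety n) (U_eps n m) (U_phi n m) (U_e n m) \<and>
    invariant_subset (U_e n m) (banded_unipotent n m) \<and>
    geometric_subcrystal n (U_variety n) (U_eps n m) (U_phi n m) (U_e n m) (banded_unipotent n m)"
proof (intro conjI)
  interpret U: invariant_band n m UNIV
    by unfold_locales (use assms in \<open>auto simp: band_UNIV intro: crystal_step_unipotent\<close>)
  interpret B: invariant_band n m "{..int m}"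
    by unfold_locales (use assms in \<open>auto intro: crystal_step_band\<close>)
  show "geometric_crystal_phi n (U_variety n) (U_eps n m) (U_phi n m) (U_e n m)"
    using U.geometric_crystal_band by (simp add: U_restrict band_variety_UNIV)
  show inv: "invariant_subset (U_e n m) (banded_unipotent n m)"
    unfolding invariant_subset_def band_atMost[symmetric] U_e_eq_crystal_step
    by (auto intro: B.step_band split: if_splits)
  show "geometric_subcrystal n (U_variety n) (U_eps n m) (U_phi n m) (U_e n m) (banded_unipotent n m)"
    unfolding geometric_subcrystal_def
    using inv closedin_banded[of n m] B.geometric_crystal_band assms(1) by (simp add: band_atMost)
qed

end
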